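(* Let $(\mathcal S,\mathcal D,E,B)$ satisfy assumptions (i)–(iv) of the context. There exists a constant $C\in(0,\infty)$ such that for any $\theta\in\mathcal S$ and $\eta_1,\eta_2\in\mathcal D_\theta$, with $\gamma_i:[0,1]\ni t\mapsto\exp_\theta(t\eta_i)$ and $T_t^i$ the optimal transport map from $\lambda_\theta$ to $\lambda_{\exp_\theta(t\eta_i)}$ ($i=1,2$), one has for all $t\in\big[0,\min\{1,\tfrac1{C\|\eta_1\|_\theta},\tfrac1{C\|\eta_2\|_\theta}\}\big)$ $$\Big|\mathrm W(\lambda_{\gamma_1(t)},\lambda_{\gamma_2(t)})-\|T_t^1-T_t^2\|_{L^2(\lambda_\theta)}\Big|\le t^2\,C\,(\|\eta_1\|_\theta+\|\eta_2\|_\theta)^2+t^{3/2}\,C\,(\|\eta_1\|_\theta+\|\eta_2\|_\theta),$$ and in particular $$\frac{d}{dt}\mathrm W(\lambda_{\gamma_1(t)},\lambda_{\gamma_2(t)})\Big|_{t=0}=\|B_\theta(\eta_1-\eta_2)\|_{L^2(\lambda_\theta)}.$$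
   Context: $\Omega\subset\mathbb R^d$ is compact and convex, $\mathcal P(\Omega)$ is the set of probability measures on $\Omega$, $\mathrm W$ is the Wasserstein-2 distance, $\mathrm W(\mu,\nu)^2=\inf_{\pi}\int|x-y|^2\,d\pi$ over couplings $\pi$ of $\mu,\nu$. For absolutely continuous $\mu$, the optimal transport map from $\mu$ to $\nu$ is the ($\mu$-a.e. unique) map $T$ such that $(\mathrm{id},T)_\#\mu$ is the optimal coupling (Brenier). $L^2(\mu)$ means $L^2(\mu;\mathbb R^d)$. $\|\cdot\|_{C^1(\mathbb R^d)}$ is the supremum norm of the function and its first derivatives. $\#$ denotes push-forward. Convention: $1/0=+\infty$; the derivative at $t=0$ is the right derivative. Assumptions. (i) $\mathcal S$ is a compact, connected, finite-dimensional smooth Riemannian manifold with tangent norms $\|\eta\|_\theta$ ($\eta\in T_\theta\mathcal S$) and induced distance $d_{\mathcal S}$. $\mathcal D\subset T\mathcal S$ is a subset on which the Riemannian exponential map is well defined, such that $(\theta,\eta)\in\mathcal D$ implies $(\theta,t\eta)\in\mathcal D$ for $t\in[0,1]$; for every $(\theta,\eta)\in\mathcal D$ the curve $\gamma(t)=\exp_\theta(t\eta)$, $t\in[0,1]$, is a constant speed geodesic from $\theta$ to $\exp_\theta(\eta)$ with $\|\dot\gamma(t)\|_{\gamma(t)}=\|\eta\|_\theta=d_{\mathcal S}(\theta,\exp_\theta(\eta))$ for $t\in[0,1]$; and, with $\mathcal D_\theta=\{\eta:(\theta,\eta)\in\mathcal D\}$, for any $\theta_0,\theta_1\in\mathcal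 S$ there is $\eta\in\mathcal D_{\theta_0}$ with $\theta_1=\exp_{\theta_0}(\eta)$. ($\mathcal S$ may have a boundary as long as it is a geodesically convex subset of a larger, not necessarily compact, such manifold and the construction of geodesics via $\mathcal D$ remains valid.) (ii) $E:\mathcal S\to\mathcal P(\Omega)$ is a bi-Lipschitz bijection from $(\mathcal S,d_{\mathcal S})$ onto $\Lambda:=E(\mathcal S)$ with metric $\mathrm W$; write $\lambda_\theta=E(\theta)$. All $\lambda\in\Lambda$ are absolutely continuous with respect to Lebesgue measure. (iii) For each $\theta\in\mathcal S$, $B_\theta:T_\theta\mathcal S\to C^1(\mathbb R^d;\mathbb R^d)$ is linear with values in gradient vector fields, and there is $C_0\in(0,\infty)$ such that for all $(\theta,\eta)\in\mathcal D$, $x\in\mathbb R^d$, $t\in[0,1]$, with $\gamma(t)=\exp_\theta(t\eta)$: $C_0^{-1}\|\eta\|_\theta\le\|B_\theta\eta\|_{L^2(\lambda_\theta)}\le C_0\|\eta\|_\theta$; $\|B_\theta\eta\|_{C^1(\mathbb R^d)}\le C_0\|\eta\|_\theta$; $|\partial_t[B_{\gamma(t)}\dot\gamma(t)](x)|\le C_0\|\eta\|_\theta^2$. (iv) For every Lipschitz curve $\gamma:[0,1]\to\mathcal S$, let $v(t,\cdot)=B_{\gamma(t)}\dot\gamma(t)$ (defined for a.e. $t$) and let $\varphi:[0,1]\times\Omega\to\mathbb R^d$ be the solution of $\varphi(0,\cdot)=\mathrm{id}$, $\partial_t\varphi(t,\cdot)=v(t,\varphi(t,\cdot))$ for a.e.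 $t$; then $\lambda_{\gamma(t)}=\varphi(t,\cdot)_\#\lambda_{\gamma(0)}$ for all $t\in[0,1]$. *)

theory Defs
  imports "HOL-Probability.Probability"
begin

section \<open>Smooth Riemannian manifolds\<close>

text \<open>\<open>Ck_on k U f\<close> is meaningful for open \<open>U\<close>: all iterated directional derivatives up to
  order \<open>k\<close> exist and are continuous.\<close>

primrec Ck_on :: "nat \<Rightarrow> 'a::euclidean_space set \<Rightarrow> ('a \<Rightarrow> 'b::real_normed_vector) \<Rightarrow> bool" where
  "Ck_on 0 U f \<longleftrightarrow> continuous_on U f"
| "Ck_on (Suc k) U f \<longleftrightarrow> (\<forall>u\<in>U. f differentiable (at u)) \<and>
     (\<forall>v. Ck_on k U (\<lambda>u. frechet_derivative f (at u) v))"

definition smooth_on :: "'a::euclidean_space set \<Rightarrow> ('a \<Rightarrow> 'b::real_normed_vector) \<Rightarrow> bool" where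
  "smooth_on U f \<longleftrightarrow> (\<forall>k. Ck_on k U f)"

text \<open>A chart is a pair (domain, coordinate map). The manifold is the whole type \<open>'p\<close>, whose
  class provides the Hausdorff and second countability axioms.\<close>

type_synonym ('p, 'e) chart = "'p set \<times> ('p \<Rightarrow> 'e)"

definition transition :: "('p, 'e) chart \<Rightarrow> ('p, 'e) chart \<Rightarrow> 'e \<Rightarrow> 'e" where
  "transition c d = snd d \<circ> inv_into (fst c) (snd c)"

definition smooth_atlas ::
  "('p::{t2_space, second_countable_topology}, 'e::euclidean_space) chart set \<Rightarrow> bool" where
  "smooth_atlas A \<longleftrightarrow> (\<Union>c\<in>A. fst c) = UNIV \<and>
     (\<forall>(U, x)\<in>A. open U \<and> open (x ` U) \<and> homeomorphism U (x ` U) x (inv_into U x)) \<and>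
     (\<forall>c\<in>A. \<forall>d\<in>A. smooth_on (snd c ` (fst c \<inter> fst d)) (transition c d))"

text \<open>A tangent vector at \<open>p\<close> is the family of its coordinate representations in the charts
  around \<open>p\<close>, related by the Jacobians of the chart changes; it is set to \<open>0\<close> on everything that
  is not a chart around \<open>p\<close>, so that equality of functions is equality of tangent vectors.\<close>

type_synonym ('p, 'e) tvec = "('p, 'e) chart \<Rightarrow> 'e"

definition tangent_space ::
  "('p, 'e::euclidean_space) chart set \<Rightarrow> 'p \<Rightarrow> ('p, 'e) tvec set" where
  "tangent_space A p = {\<eta>.
     (\<forall>c\<in>A. \<forall>d\<in>A. p \<in> fst c \<inter> fst d \<longrightarrow>
        \<eta> d = frechet_derivative (transition c d) (at (snd c p)) (\<eta> c)) \<and>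
     (\<forall>c. \<not> (c \<in> A \<and> p \<in> fst c) \<longrightarrow> \<eta> c = 0)}"

definition tv_lincomb ::
  "real \<Rightarrow> ('p, 'e::euclidean_space) tvec \<Rightarrow> real \<Rightarrow> ('p, 'e) tvec \<Rightarrow> ('p, 'e) tvec" where
  "tv_lincomb a \<eta> b \<xi> = (\<lambda>c. a *\<^sub>R \<eta> c + b *\<^sub>R \<xi> c)"

definition tv_scale :: "real \<Rightarrow> ('p, 'e::euclidean_space) tvec \<Rightarrow> ('p, 'e) tvec" where
  "tv_scale t \<eta> = (\<lambda>c. t *\<^sub>R \<eta> c)"

definition tv_diff ::
  "('p, 'e::euclidean_space) tvec \<Rightarrow> ('p, 'e) tvec \<Rightarrow> ('p, 'e) tvec" where
  "tv_diff \<eta> \<xi> = (\<lambda>c. \<eta> c - \<xi> c)"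

text \<open>The tangent vector at \<open>p\<close> whose representation in the chart \<open>c\<close> is \<open>v\<close>.\<close>

definition coord_tvec ::
  "('p, 'e::euclidean_space) chart set \<Rightarrow> 'p \<Rightarrow> ('p, 'e) chart \<Rightarrow> 'e \<Rightarrow> ('p, 'e) tvec" where
  "coord_tvec A p c v = (\<lambda>d. if d \<in> A \<and> p \<in> fst d
     then frechet_derivative (transition c d) (at (snd c p)) v else 0)"

type_synonym ('p, 'e) metric_tensor = "'p \<Rightarrow> ('p, 'e) tvec \<Rightarrow> ('p, 'e) tvec \<Rightarrow> real"

text \<open>The metric tensor in the coordinates of the chart \<open>c\<close>, at the coordinate point \<open>u\<close>.\<close>

definition metric_coord ::
  "('p, 'e::euclidean_space) chart set \<Rightarrow> ('p, 'e) metric_tensor \<Rightarrow> ('p, 'e) chart \<Rightarrow>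
    'e \<Rightarrow> 'e \<Rightarrow> 'e \<Rightarrow> real" where
  "metric_coord A g c u a b = (let p = inv_into (fst c) (snd c) u in
     g p (coord_tvec A p c a) (coord_tvec A p c b))"

definition riemannian_metric ::
  "('p, 'e::euclidean_space) chart set \<Rightarrow> ('p, 'e) metric_tensor \<Rightarrow> bool" where
  "riemannian_metric A g \<longleftrightarrow>
     (\<forall>p. \<forall>\<eta>\<in>tangent_space A p. \<forall>\<xi>\<in>tangent_space A p. g p \<eta> \<xi> = g p \<xi> \<eta>) \<and>
     (\<forall>p. \<forall>\<eta>\<in>tangent_space A p. \<forall>\<xi>\<in>tangent_space A p. \<forall>\<zeta>\<in>tangent_space A p. \<forall>a b.
        g p (tv_lincomb a \<eta> b \<xi>) \<zeta> = a * g p \<eta> \<zeta> + b * g p \<xi> \<zeta>) \<and>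
     (\<forall>p. \<forall>\<eta>\<in>tangent_space A p. \<eta> \<noteq> (\<lambda>c. 0) \<longrightarrow> g p \<eta> \<eta> > 0) \<and>
     (\<forall>c\<in>A. \<forall>a b. smooth_on (snd c ` fst c) (\<lambda>u. metric_coord A g c u a b))"

definition riemannian_manifold ::
  "('p::{t2_space, second_countable_topology}, 'e::euclidean_space) chart set \<Rightarrow>
    ('p, 'e) metric_tensor \<Rightarrow> bool" where
  "riemannian_manifold A g \<longleftrightarrow>
     smooth_atlas A \<and> riemannian_metric A g \<and> connected (UNIV :: 'p set)"

definition tnorm :: "('p, 'e) metric_tensor \<Rightarrow> 'p \<Rightarrow> ('p, 'e) tvec \<Rightarrow> real" where
  "tnorm g p \<eta> = sqrt (g p \<eta> \<eta>)"


section \<open>Curves, induced distance, geodesics, exponential map\<close>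

text \<open>Continuity of \<open>\<gamma>\<close> at \<open>t\<close> has to be required separately: a coordinate map is unspecified
  outside its domain.\<close>

definition has_velocity ::
  "('p::topological_space, 'e::euclidean_space) chart set \<Rightarrow> real set \<Rightarrow> (real \<Rightarrow> 'p) \<Rightarrow> real \<Rightarrow>
    ('p, 'e) tvec \<Rightarrow> bool" where
  "has_velocity A I \<gamma> t w \<longleftrightarrow> w \<in> tangent_space A (\<gamma> t) \<and> (\<gamma> \<longlongrightarrow> \<gamma> t) (at t within I) \<and>
     (\<forall>c\<in>A. \<gamma> t \<in> fst c \<longrightarrow> ((snd c \<circ> \<gamma>) has_vector_derivative w c) (at t within I))"

definition velocity ::
  "('p::topological_space, 'e::euclidean_space) chart set \<Rightarrow> real set \<Rightarrow> (real \<Rightarrow> 'p) \<Rightarrow> real \<Rightarrow>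
    ('p, 'e) tvec" where
  "velocity A I \<gamma> t = (THE w. has_velocity A I \<gamma> t w)"

definition C1_curve ::
  "('p::topological_space, 'e::euclidean_space) chart set \<Rightarrow> real \<Rightarrow> real \<Rightarrow> (real \<Rightarrow> 'p) \<Rightarrow>
    bool" where
  "C1_curve A a b \<gamma> \<longleftrightarrow>
     (\<forall>t\<in>{a..b}. has_velocity A {a..b} \<gamma> t (velocity A {a..b} \<gamma> t)) \<and>
     (\<forall>c\<in>A. continuous_on {t\<in>{a..b}. \<gamma> t \<in> fst c} (\<lambda>t. velocity A {a..b} \<gamma> t c))"

definition piecewise_C1_curve ::
  "('p::topological_space, 'e::euclidean_space) chart set \<Rightarrow> real \<Rightarrow> real \<Rightarrow> (real \<Rightarrow> 'p) \<Rightarrow>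
    bool" where
  "piecewise_C1_curve A a b \<gamma> \<longleftrightarrow> continuous_on {a..b} \<gamma> \<and>
     (\<exists>F. finite F \<and>
        (\<forall>s t. a \<le> s \<and> s < t \<and> t \<le> b \<and> F \<inter> {s<..<t} = {} \<longrightarrow> C1_curve A s t \<gamma>))"

definition curve_length ::
  "('p::topological_space, 'e::euclidean_space) chart set \<Rightarrow> ('p, 'e) metric_tensor \<Rightarrow>
    real \<Rightarrow> real \<Rightarrow> (real \<Rightarrow> 'p) \<Rightarrow> real" where
  "curve_length A g a b \<gamma> = integral {a..b} (\<lambda>t. tnorm g (\<gamma> t) (velocity A {a..b} \<gamma> t))"

text \<open>The distance on \<open>S\<close> only uses curves inside \<open>S\<close>.\<close>

definition induced_dist ::
  "('p::topological_space, 'e::euclidean_space) chart set \<Rightarrow> ('p, 'e) metric_tensor \<Rightarrow>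
    'p set \<Rightarrow> 'p \<Rightarrow> 'p \<Rightarrow> real" where
  "induced_dist A g S p q = Inf {curve_length A g a b \<gamma> | a b \<gamma>.
     a \<le> b \<and> piecewise_C1_curve A a b \<gamma> \<and> \<gamma> ` {a..b} \<subseteq> S \<and> \<gamma> a = p \<and> \<gamma> b = q}"

text \<open>The vector with components \<open>\<Gamma>\<^sup>k\<^sub>i\<^sub>j a\<^sup>i b\<^sup>j\<close>, characterised by the Koszul formula
  \<open>g(\<Gamma>(a,b), e) = (\<partial>\<^sub>a g(b,e) + \<partial>\<^sub>b g(a,e) - \<partial>\<^sub>e g(a,b)) / 2\<close>.\<close>

definition christoffel ::
  "('p, 'e::euclidean_space) chart set \<Rightarrow> ('p, 'e) metric_tensor \<Rightarrow> ('p, 'e) chart \<Rightarrow>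
    'e \<Rightarrow> 'e \<Rightarrow> 'e \<Rightarrow> 'e" where
  "christoffel A g c u a b = (THE z. \<forall>e. metric_coord A g c u z e =
     (frechet_derivative (\<lambda>u. metric_coord A g c u b e) (at u) a
      + frechet_derivative (\<lambda>u. metric_coord A g c u a e) (at u) b
      - frechet_derivative (\<lambda>u. metric_coord A g c u a b) (at u) e) / 2)"

definition geodesic ::
  "('p::topological_space, 'e::euclidean_space) chart set \<Rightarrow> ('p, 'e) metric_tensor \<Rightarrow>
    real set \<Rightarrow> (real \<Rightarrow> 'p) \<Rightarrow> bool" where
  "geodesic A g I \<gamma> \<longleftrightarrow> (\<forall>t\<in>I. has_velocity A I \<gamma> t (velocity A I \<gamma> t) \<and>
     (\<forall>c\<in>A. \<gamma> t \<in> fst c \<longrightarrow> ((\<lambda>s. velocity A I \<gamma> s c) has_vector_derivative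
        - christoffel A g c (snd c (\<gamma> t)) (velocity A I \<gamma> t c) (velocity A I \<gamma> t c))
        (at t within I)))"

definition geodesic_from ::
  "('p::topological_space, 'e::euclidean_space) chart set \<Rightarrow> ('p, 'e) metric_tensor \<Rightarrow>
    'p \<Rightarrow> ('p, 'e) tvec \<Rightarrow> (real \<Rightarrow> 'p) \<Rightarrow> bool" where
  "geodesic_from A g \<theta> \<eta> \<gamma> \<longleftrightarrow>
     geodesic A g {0..1} \<gamma> \<and> \<gamma> 0 = \<theta> \<and> velocity A {0..1} \<gamma> 0 = \<eta>"

definition exp_map ::
  "('p::topological_space, 'e::euclidean_space) chart set \<Rightarrow> ('p, 'e) metric_tensor \<Rightarrow>
    'p \<Rightarrow> ('p, 'e) tvec \<Rightarrow> 'p" where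
  "exp_map A g \<theta> \<eta> = (THE q. \<exists>\<gamma>. geodesic_from A g \<theta> \<eta> \<gamma> \<and> \<gamma> 1 = q)"

definition exp_curve ::
  "('p::topological_space, 'e::euclidean_space) chart set \<Rightarrow> ('p, 'e) metric_tensor \<Rightarrow>
    'p \<Rightarrow> ('p, 'e) tvec \<Rightarrow> real \<Rightarrow> 'p" where
  "exp_curve A g \<theta> \<eta> = (\<lambda>t. exp_map A g \<theta> (tv_scale t \<eta>))"

definition geodesically_convex ::
  "('p::topological_space, 'e::euclidean_space) chart set \<Rightarrow> ('p, 'e) metric_tensor \<Rightarrow>
    'p set \<Rightarrow> bool" where
  "geodesically_convex A g S \<longleftrightarrow> (\<forall>p\<in>S. \<forall>q\<in>S. \<exists>\<gamma>. geodesic A g {0..1} \<gamma> \<and>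
     \<gamma> ` {0..1} \<subseteq> S \<and> \<gamma> 0 = p \<and> \<gamma> 1 = q \<and>
     curve_length A g 0 1 \<gamma> = induced_dist A g UNIV p q)"

text \<open>\<open>S\<close> is either the whole manifold, or (so that it may have a boundary) a geodesically convex
  subset of it; in the second case the ambient manifold need not be compact.\<close>

definition parameter_manifold ::
  "('p::{t2_space, second_countable_topology}, 'e::euclidean_space) chart set \<Rightarrow>
    ('p, 'e) metric_tensor \<Rightarrow> 'p set \<Rightarrow> bool" where
  "parameter_manifold A g S \<longleftrightarrow> riemannian_manifold A g \<and> compact S \<and> connected S \<and>
     (S = UNIV \<or> geodesically_convex A g S)"

definition exp_domain ::
  "('p::topological_space, 'e::euclidean_space) chart set \<Rightarrow> ('p, 'e) metric_tensor \<Rightarrow>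
    'p set \<Rightarrow> ('p \<times> ('p, 'e) tvec) set \<Rightarrow> bool" where
  "exp_domain A g S D \<longleftrightarrow>
     (\<forall>(\<theta>, \<eta>)\<in>D. \<theta> \<in> S \<and> \<eta> \<in> tangent_space A \<theta> \<and> (\<exists>\<gamma>. geodesic_from A g \<theta> \<eta> \<gamma>)) \<and>
     (\<forall>(\<theta>, \<eta>)\<in>D. \<forall>t\<in>{0..1}. (\<theta>, tv_scale t \<eta>) \<in> D) \<and>
     (\<forall>(\<theta>, \<eta>)\<in>D. let \<gamma> = exp_curve A g \<theta> \<eta> in
        geodesic_from A g \<theta> \<eta> \<gamma> \<and> \<gamma> ` {0..1} \<subseteq> S \<and>
        (\<forall>t\<in>{0..1}. tnorm g (\<gamma> t) (velocity A {0..1} \<gamma> t) = tnorm g \<theta> \<eta>) \<and>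
        tnorm g \<theta> \<eta> = induced_dist A g S \<theta> (exp_map A g \<theta> \<eta>)) \<and>
     (\<forall>\<theta>\<^sub>0\<in>S. \<forall>\<theta>\<^sub>1\<in>S. \<exists>\<eta>. (\<theta>\<^sub>0, \<eta>) \<in> D \<and> \<theta>\<^sub>1 = exp_map A g \<theta>\<^sub>0 \<eta>)"


section \<open>Optimal transport\<close>

definition prob_measures_on :: "'a::euclidean_space set \<Rightarrow> 'a measure set" where
  "prob_measures_on \<Omega> = {\<mu>. prob_space \<mu> \<and> sets \<mu> = sets borel \<and> emeasure \<mu> \<Omega> = 1}"

definition couplings ::
  "'a::euclidean_space measure \<Rightarrow> 'a measure \<Rightarrow> ('a \<times> 'a) measure set" where
  "couplings \<mu> \<nu> = {\<pi>. sets \<pi> = sets borel \<and> distr \<pi> borel fst = \<mu> \<and> distr \<pi> borel snd = \<nu>}"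

definition transport_cost :: "('a::euclidean_space \<times> 'a) measure \<Rightarrow> ennreal" where
  "transport_cost \<pi> = (\<integral>\<^sup>+ (x, y). ennreal ((norm (x - y))\<^sup>2) \<partial>\<pi>)"

definition wasserstein :: "'a::euclidean_space measure \<Rightarrow> 'a measure \<Rightarrow> real" where
  "wasserstein \<mu> \<nu> = sqrt (enn2real (INF \<pi>\<in>couplings \<mu> \<nu>. transport_cost \<pi>))"

definition optimal_coupling ::
  "'a::euclidean_space measure \<Rightarrow> 'a measure \<Rightarrow> ('a \<times> 'a) measure \<Rightarrow> bool" where
  "optimal_coupling \<mu> \<nu> \<pi> \<longleftrightarrow> \<pi> \<in> couplings \<mu> \<nu> \<and>
     transport_cost \<pi> = (INF \<pi>'\<in>couplings \<mu> \<nu>. transport_cost \<pi>')"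

text \<open>For absolutely continuous \<open>\<mu>\<close> this determines \<open>T\<close> up to \<open>\<mu>\<close>-null sets.\<close>

definition optimal_map ::
  "'a::euclidean_space measure \<Rightarrow> 'a measure \<Rightarrow> ('a \<Rightarrow> 'a) \<Rightarrow> bool" where
  "optimal_map \<mu> \<nu> T \<longleftrightarrow> T \<in> borel_measurable borel \<and>
     optimal_coupling \<mu> \<nu> (distr \<mu> borel (\<lambda>x. (x, T x)))"

definition L2_norm :: "'a::euclidean_space measure \<Rightarrow> ('a \<Rightarrow> 'a) \<Rightarrow> real" where
  "L2_norm \<mu> f = sqrt (\<integral>x. (norm (f x))\<^sup>2 \<partial>\<mu>)"

definition measure_embedding ::
  "('p::topological_space, 'e::euclidean_space) chart set \<Rightarrow> ('p, 'e) metric_tensor \<Rightarrow>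
    'p set \<Rightarrow> 'a::euclidean_space set \<Rightarrow> ('p \<Rightarrow> 'a measure) \<Rightarrow> bool" where
  "measure_embedding A g S \<Omega> E \<longleftrightarrow>
     E ` S \<subseteq> prob_measures_on \<Omega> \<and> inj_on E S \<and>
     (\<exists>L>0. \<forall>\<theta>\<in>S. \<forall>\<theta>'\<in>S.
        induced_dist A g S \<theta> \<theta>' / L \<le> wasserstein (E \<theta>) (E \<theta>') \<and>
        wasserstein (E \<theta>) (E \<theta>') \<le> L * induced_dist A g S \<theta> \<theta>') \<and>
     (\<forall>\<theta>\<in>S. absolutely_continuous lborel (E \<theta>))"


section \<open>Velocity fields and flows\<close>

definition gradient_field :: "('a::euclidean_space \<Rightarrow> 'a) \<Rightarrow> bool" where
  "gradient_field f \<longleftrightarrow> (\<exists>\<psi>. \<forall>x. GDERIV \<psi> x :> f x)"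

text \<open>Extended-real valued, hence \<open>\<infinity>\<close> when the function or its derivative is unbounded.\<close>

definition C1_norm :: "('a::euclidean_space \<Rightarrow> 'a) \<Rightarrow> ereal" where
  "C1_norm f = (SUP x. max (ereal (norm (f x))) (ereal (onorm (frechet_derivative f (at x)))))"

definition velocity_fields ::
  "('p::topological_space, 'e::euclidean_space) chart set \<Rightarrow> ('p, 'e) metric_tensor \<Rightarrow>
    'p set \<Rightarrow> ('p \<times> ('p, 'e) tvec) set \<Rightarrow> ('p \<Rightarrow> 'a::euclidean_space measure) \<Rightarrow>
    ('p \<Rightarrow> ('p, 'e) tvec \<Rightarrow> 'a \<Rightarrow> 'a) \<Rightarrow> bool" where
  "velocity_fields A g S D E B \<longleftrightarrow>
     (\<forall>\<theta>\<in>S. \<forall>\<eta>\<in>tangent_space A \<theta>. Ck_on 1 UNIV (B \<theta> \<eta>) \<and> gradient_field (B \<theta> \<eta>)) \<and>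
     (\<forall>\<theta>\<in>S. \<forall>\<eta>\<in>tangent_space A \<theta>. \<forall>\<xi>\<in>tangent_space A \<theta>. \<forall>a b x.
        B \<theta> (tv_lincomb a \<eta> b \<xi>) x = a *\<^sub>R B \<theta> \<eta> x + b *\<^sub>R B \<theta> \<xi> x) \<and>
     (\<exists>C\<^sub>0>0. \<forall>(\<theta>, \<eta>)\<in>D.
        tnorm g \<theta> \<eta> / C\<^sub>0 \<le> L2_norm (E \<theta>) (B \<theta> \<eta>) \<and>
        L2_norm (E \<theta>) (B \<theta> \<eta>) \<le> C\<^sub>0 * tnorm g \<theta> \<eta> \<and>
        C1_norm (B \<theta> \<eta>) \<le> ereal (C\<^sub>0 * tnorm g \<theta> \<eta>) \<and>
        (let \<gamma> = exp_curve A g \<theta> \<eta> in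
           \<forall>x. \<forall>t\<in>{0..1}. \<exists>\<delta>.
             ((\<lambda>s. B (\<gamma> s) (velocity A {0..1} \<gamma> s) x) has_vector_derivative \<delta>)
               (at t within {0..1}) \<and>
             norm \<delta> \<le> C\<^sub>0 * (tnorm g \<theta> \<eta>)\<^sup>2))"

definition abs_continuous_on :: "real \<Rightarrow> real \<Rightarrow> (real \<Rightarrow> 'a::real_normed_vector) \<Rightarrow> bool" where
  "abs_continuous_on a b f \<longleftrightarrow> (\<forall>\<epsilon>>0. \<exists>\<delta>>0. \<forall>J. finite J \<and>
     (\<forall>(s, t)\<in>J. a \<le> s \<and> s \<le> t \<and> t \<le> b) \<and>
     pairwise (\<lambda>(s, t) (s', t'). {s<..<t} \<inter> {s'<..<t'} = {}) J \<and>
     (\<Sum>(s, t)\<in>J. t - s) < \<delta> \<longrightarrow> (\<Sum>(s, t)\<in>J. norm (f t - f s)) < \<epsilon>)"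

definition lipschitz_curve ::
  "('p::topological_space, 'e::euclidean_space) chart set \<Rightarrow> ('p, 'e) metric_tensor \<Rightarrow>
    'p set \<Rightarrow> (real \<Rightarrow> 'p) \<Rightarrow> bool" where
  "lipschitz_curve A g S \<gamma> \<longleftrightarrow> \<gamma> ` {0..1} \<subseteq> S \<and>
     (\<exists>L. \<forall>s\<in>{0..1}. \<forall>t\<in>{0..1}. induced_dist A g S (\<gamma> s) (\<gamma> t) \<le> L * \<bar>s - t\<bar>)"

text \<open>Solutions in the sense of Caratheodory: absolutely continuous in time, with the differential
  equation at almost every time.\<close>

definition flow_along ::
  "('p::topological_space, 'e::euclidean_space) chart set \<Rightarrow> 'a::euclidean_space set \<Rightarrow>
    ('p \<Rightarrow> ('p, 'e) tvec \<Rightarrow> 'a \<Rightarrow> 'a) \<Rightarrow> (real \<Rightarrow> 'p) \<Rightarrow> (real \<Rightarrow> 'a \<Rightarrow> 'a) \<Rightarrow> bool" where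
  "flow_along A \<Omega> B \<gamma> \<phi> \<longleftrightarrow>
     (\<forall>x\<in>\<Omega>. \<phi> 0 x = x \<and> abs_continuous_on 0 1 (\<lambda>t. \<phi> t x)) \<and>
     (AE t in lborel. t \<in> {0..1} \<longrightarrow> (\<exists>w. has_velocity A {0..1} \<gamma> t w \<and>
        (\<forall>x\<in>\<Omega>. ((\<lambda>s. \<phi> s x) has_vector_derivative B (\<gamma> t) w (\<phi> t x)) (at t within {0..1}))))"

text \<open>\<open>\<phi> t\<close> is only specified on \<open>\<Omega>\<close>, which carries the full mass of the measures; hence the
  restriction before taking the push-forward.\<close>

definition transported_by_flow ::
  "('p::topological_space, 'e::euclidean_space) chart set \<Rightarrow> ('p, 'e) metric_tensor \<Rightarrow>
    'p set \<Rightarrow> 'a::euclidean_space set \<Rightarrow> ('p \<Rightarrow> 'a measure) \<Rightarrow>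
    ('p \<Rightarrow> ('p, 'e) tvec \<Rightarrow> 'a \<Rightarrow> 'a) \<Rightarrow> bool" where
  "transported_by_flow A g S \<Omega> E B \<longleftrightarrow>
     (\<forall>\<gamma> \<phi>. lipschitz_curve A g S \<gamma> \<and> flow_along A \<Omega> B \<gamma> \<phi> \<longrightarrow>
        (\<forall>t\<in>{0..1}. E (\<gamma> t) = distr (restrict_space (E (\<gamma> 0)) \<Omega>) borel (\<phi> t)))"

end

theory Submission
  imports Defs "HOL-Complex_Analysis.Great_Picard"
begin

text \<open>Let \<open>p\<^sub>i\<close> be the time \<open>t\<close> map of the flow along \<open>\<gamma>\<^sub>i\<close>, which transports \<open>\<lambda>\<^sub>\<theta>\<close> to
  \<open>\<lambda>\<^bsub>\<gamma>\<^sub>i(t)\<^esub>\<close>; it is \<open>id + t B\<^sub>\<theta> \<eta>\<^sub>i + O(t\<^sup>2)\<close>. Since \<open>t B\<^sub>\<theta> \<eta>\<^sub>i\<close> is a gradient with Lipschitz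
  constant \<open>O(t)\<close>, integrating its potential against the marginals shows that a coupling can beat
  one that moves mass along this gradient only by a factor \<open>1 + O(t)\<close> in the cost. For the coupling
  \<open>(p\<^sub>1, p\<^sub>2)\<close> and the gradient \<open>t B\<^sub>\<theta> (\<eta>\<^sub>2 - \<eta>\<^sub>1)\<close> this gives \<open>W = t \<parallel>B\<^sub>\<theta> (\<eta>\<^sub>1 - \<eta>\<^sub>2)\<parallel> + O(t\<^sup>2)\<close>; for
  \<open>(id, p\<^sub>i)\<close> it gives \<open>\<parallel>T\<^sub>i - id - t B\<^sub>\<theta> \<eta>\<^sub>i\<parallel> = O(t\<^bsup>3/2\<^esup>)\<close>. All tangent vectors in \<open>D\<close> are bounded
  because \<open>E\<close> is bi-Lipschitz and \<open>\<Omega>\<close> is bounded, so both estimates hold on all of \<open>[0, 1]\<close>.\<close>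

section \<open>Peano's existence theorem\<close>

text \<open>The two orders come from one loss. A gradient with Lipschitz constant K = O(t) is blind
  to an amount K times a cost O(t^2), hence O(t^3), in squared quantities. For W the difference of
  squares is factored, which divides the loss by a norm of order t and leaves O(t^2). For the
  optimal maps the squared quantity is the deviation itself, and its root is of order t^(3/2).

  The flow is assembled from integral curves chosen point by point. They need not be unique, nor
  depend measurably on the starting point. This does no harm: the transport assumption speaks of
  every family of solutions, and the resulting push-forward identity gives measurability back. The
  bound on the tangent vectors also absorbs surplus powers of their norms into the constant. That is
  why the t^2 term is quadratic and the t^(3/2) term only linear in these norms.\<close>

text \<open>With a delay \<open>h\<close> the Picard iteration becomes stationary on \<open>[0, j h]\<close> after \<open>j\<close> steps.\<close>

primrec delayed_picard ::
  "(real \<Rightarrow> 'a \<Rightarrow> 'a::euclidean_space) \<Rightarrow> 'a \<Rightarrow> real \<Rightarrow> nat \<Rightarrow> real \<Rightarrow> 'a" where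
  "delayed_picard v x h 0 = (\<lambda>t. x)"
| "delayed_picard v x h (Suc j) =
     (\<lambda>t. x + integral {0..t} (\<lambda>s. v s (delayed_picard v x h j (max 0 (s - h)))))"

lemma continuous_on_delayed:
  fixes v :: "real \<Rightarrow> 'a::euclidean_space \<Rightarrow> 'a"
  assumes v: "continuous_on UNIV (\<lambda>z. v (fst z) (snd z))"
    and z: "continuous_on {0..} z" and h: "0 \<le> h"
  shows "continuous_on {0..t} (\<lambda>s. v s (z (max 0 (s - h))))"
proof -
  have "continuous_on {0..t} (\<lambda>s. z (max 0 (s - h)))"
    by (rule continuous_on_compose2[OF z]) (auto intro!: continuous_intros)
  then have "continuous_on {0..t} (\<lambda>s. (s, z (max 0 (s - h))))"
    by (intro continuous_intros)
  from continuous_on_compose2[OF v this] show ?thesis by simp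
qed

lemma lipschitz_integral:
  fixes f :: "real \<Rightarrow> 'a::euclidean_space"
  assumes f: "\<And>t. continuous_on {0..t} f" and M: "\<And>s. norm (f s) \<le> M" and "0 \<le> s" "s \<le> t"
  shows "norm (integral {0..t} f - integral {0..s} f) \<le> M * (t - s)"
proof -
  have "integral {0..s} f + integral {s..t} f = integral {0..t} f"
    using assms by (intro Henstock_Kurzweil_Integration.integral_combine integrable_continuous_real) auto
  then have "integral {0..t} f - integral {0..s} f = integral {s..t} f"
    by (simp add: algebra_simps)
  also have "norm \<dots> \<le> M * (t - s)"
    using assms by (intro integral_bound M continuous_on_subset[OF f[of t]]) auto
  finally show ?thesis .
qed

lemma lipschitz_on_halflineI:
  fixes z :: "real \<Rightarrow> 'a::euclidean_space"
  assumes "\<And>s t. 0 \<le> s \<Longrightarrow> s \<le> t \<Longrightarrow> norm (z t - z s) \<le> M * (t - s)"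
  shows "M-lipschitz_on {0..} z"
proof (rule lipschitz_onI)
  show "0 \<le> M" using order_trans[OF norm_ge_zero assms[of 0 1]] by simp
  fix s t :: real assume "s \<in> {0..}" "t \<in> {0..}"
  then show "dist (z s) (z t) \<le> M * dist s t"
    using assms[of s t] assms[of t s]
    by (cases "s \<le> t") (auto simp: dist_norm norm_minus_commute abs_if)
qed

text \<open>The bound \<open>M\<close> of the field serves as Lipschitz constant for every delay and
  every iterate; this uniformity is the equicontinuity behind the compactness argument.\<close>

lemma delayed_picard_lipschitz:
  fixes v :: "real \<Rightarrow> 'a::euclidean_space \<Rightarrow> 'a"
  assumes v: "continuous_on UNIV (\<lambda>z. v (fst z) (snd z))" and M: "\<And>t x. norm (v t x) \<le> M"
    and h: "0 \<le> h"
  shows "M-lipschitz_on {0..} (delayed_picard v x h j)"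
proof (induction j)
  case 0
  have "0 \<le> M" using M[of 0 0] norm_ge_zero order_trans by blast
  then show ?case by (auto simp: lipschitz_on_def)
next
  case (Suc j)
  show ?case
  proof (rule lipschitz_on_halflineI)
    fix s t :: real assume "0 \<le> s" "s \<le> t"
    with lipschitz_integral[OF continuous_on_delayed[OF v lipschitz_on_continuous_on[OF Suc] h] M]
    show "norm (delayed_picard v x h (Suc j) t - delayed_picard v x h (Suc j) s) \<le> M * (t - s)"
      by simp
  qed
qed

text \<open>Up to time \<open>t\<close> an iterate reads its predecessor only up to
  \<open>max 0 (t - h)\<close>, so each step extends the range of agreement by one \<open>h\<close>.
  For \<open>j = 0\<close> only \<open>t = 0\<close> remains, where the integral vanishes.\<close>

lemma delayed_picard_stable:
  assumes "0 \<le> t" "t \<le> real j * h" "0 \<le> h"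
  shows "delayed_picard v x h (Suc j) t = delayed_picard v x h j t"
  using assms
proof (induction j arbitrary: t)
  case 0
  then show ?case by simp
next
  case (Suc j)
  have "delayed_picard v x h (Suc j) (max 0 (s - h)) = delayed_picard v x h j (max 0 (s - h))"
    if "s \<in> {0..t}" for s
    using that Suc.prems by (intro Suc.IH) (auto simp: algebra_simps)
  then have "integral {0..t} (\<lambda>s. v s (delayed_picard v x h (Suc j) (max 0 (s - h)))) =
      integral {0..t} (\<lambda>s. v s (delayed_picard v x h j (max 0 (s - h))))"
    by (intro integral_cong) (simp del: delayed_picard.simps)
  then show ?case by simp
qed

text \<open>The functions \<open>z k\<close> solve the integral equation exactly, except that the
  field sees a position that is \<open>h k\<close> too old. Arzela-Ascoli yields a uniformly
  convergent subsequence, and the delay disappears in the limit. The global bound \<open>M\<close>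
  excludes blow-up, so the solution lives on the whole unit interval.\<close>

theorem peano_existence:
  fixes v :: "real \<Rightarrow> 'a::euclidean_space \<Rightarrow> 'a"
  assumes v: "continuous_on UNIV (\<lambda>z. v (fst z) (snd z))" and M: "\<And>t x. norm (v t x) \<le> M"
  obtains y where "y 0 = x" "continuous_on {0..1} y"
    "\<And>t. t \<in> {0..1} \<Longrightarrow> (y has_vector_derivative v t (y t)) (at t within {0..1})"
proof -
  have M0: "0 \<le> M" using M[of 0 0] norm_ge_zero order_trans by blast
  \<comment> \<open>The delay is matched to the number of iterations: \<open>Suc k\<close> steps of
    size \<open>h k\<close> reach exactly time 1, so on \<open>{0..1}\<close> one more iteration
    does not change \<open>z k\<close>.\<close>
  define h :: "nat \<Rightarrow> real" where "h k = 1 / real (Suc k)" for k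
  define z where "z k = delayed_picard v x (h k) (Suc k)" for k
  have h: "0 \<le> h k" "real (Suc k) * h k = 1" for k by (auto simp: h_def)
  have lip: "M-lipschitz_on {0..} (z k)" for k
    unfolding z_def by (rule delayed_picard_lipschitz[OF v M h(1)])
  have zlip: "norm (z k s - z k t) \<le> M * \<bar>s - t\<bar>" if "0 \<le> s" "0 \<le> t" for k s t
    using lipschitz_onD[OF lip[of k], of s t] that by (simp add: dist_norm)
  have zeq: "z k t = x + integral {0..t} (\<lambda>s. v s (z k (max 0 (s - h k))))"
    if "t \<in> {0..1}" for k t
  proof -
    have "delayed_picard v x (h k) (Suc (Suc k)) t = delayed_picard v x (h k) (Suc k) t"
      using that h[of k] by (intro delayed_picard_stable) (simp_all del: delayed_picard.simps of_nat_Suc)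
    then show ?thesis unfolding z_def by (simp only: delayed_picard.simps(2)[of v x "h k" "Suc k"])
  qed
  have z0: "z k 0 = x" for k using zeq[of 0 k] by simp
  obtain y r where y: "continuous_on {0..1} y" and r: "strict_mono (r :: nat \<Rightarrow> nat)"
    and yr: "\<And>e. 0 < e \<Longrightarrow> \<exists>N. \<forall>n t. n \<ge> N \<and> t \<in> {0..1} \<longrightarrow> norm (z (r n) t - y t) < e"
  proof (rule Arzela_Ascoli[of "{0..1::real}" z "norm x + M"])
    show "norm (z n t) \<le> norm x + M" if "t \<in> {0..1}" for n t
    proof -
      have "norm (z n t) \<le> norm x + norm (z n t - z n 0)"
        unfolding z0 using norm_triangle_sub by blast
      also have "\<dots> \<le> norm x + M * \<bar>t - 0\<bar>" using zlip[of t 0 n] that by (simp add: z0)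
      also have "\<dots> \<le> norm x + M * 1" using that M0 by (intro add_left_mono mult_left_mono) auto
      finally show ?thesis by simp
    qed
    show "\<exists>d>0. \<forall>n t. t \<in> {0..1} \<and> norm (s - t) < d \<longrightarrow> norm (z n s - z n t) < e"
      if "s \<in> {0..1}" "0 < e" for s e
    proof (intro exI conjI allI impI)
      show "0 < e / (M + 1)" using M0 that by simp
      fix n t assume t: "t \<in> {0..1} \<and> norm (s - t) < e / (M + 1)"
      have "norm (z n s - z n t) \<le> M * \<bar>s - t\<bar>" using that t by (intro zlip) auto
      also have "\<dots> \<le> (M + 1) * \<bar>s - t\<bar>" by (intro mult_right_mono) auto
      also have "\<dots> < e" using t M0 by (simp add: field_simps)
      finally show "norm (z n s - z n t) < e" .
    qed
  qed auto
  have lim: "(\<lambda>n. z (r n) t) \<longlonglongrightarrow> y t" if "t \<in> {0..1}" for t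
    unfolding LIMSEQ_iff using yr that by meson
  have "h \<longlonglongrightarrow> 0" unfolding h_def by (rule LIMSEQ_Suc[OF lim_1_over_n])
  then have hr: "(\<lambda>n. h (r n)) \<longlonglongrightarrow> 0"
    using r LIMSEQ_subseq_LIMSEQ[of h 0 r] by (simp add: o_def)
  \<comment> \<open>Shifting the argument by the delay costs at most \<open>M * h (r n)\<close>, by
    the common Lipschitz bound.\<close>
  have limd: "(\<lambda>n. z (r n) (max 0 (s - h (r n)))) \<longlonglongrightarrow> y s" if s: "s \<in> {0..1}" for s
  proof (rule Lim_transform[OF lim[OF s]])
    have le: "norm (z (r n) (max 0 (s - h (r n))) - z (r n) s) \<le> M * h (r n)" for n
    proof -
      have "norm (z (r n) (max 0 (s - h (r n))) - z (r n) s) \<le> M * \<bar>max 0 (s - h (r n)) - s\<bar>"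
        using s by (intro zlip) auto
      also have "\<dots> \<le> M * h (r n)" using s h(1)[of "r n"] M0 by (intro mult_left_mono) auto
      finally show ?thesis .
    qed
    have null: "(\<lambda>n. M * h (r n)) \<longlonglongrightarrow> 0" using tendsto_mult_right_zero[OF hr] by blast
    show "(\<lambda>n. z (r n) (max 0 (s - h (r n))) - z (r n) s) \<longlonglongrightarrow> 0"
      by (rule Lim_null_comparison[OF always_eventually[OF allI[OF le]] null])
  qed
  have vc: "continuous_on UNIV (v s)" for s
  proof -
    have "continuous_on UNIV (\<lambda>x. (s, x))" by (intro continuous_intros)
    from continuous_on_compose2[OF v this] show ?thesis by simp
  qed
  have yeq: "y t = x + integral {0..t} (\<lambda>s. v s (y s))" if t: "t \<in> {0..1}" for t
  proof -
    have "(\<lambda>n. integral {0..t} (\<lambda>s. v s (z (r n) (max 0 (s - h (r n)))))) \<longlonglongrightarrow>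
        integral {0..t} (\<lambda>s. v s (y s))"
    proof (rule dominated_convergence(2)[where h="\<lambda>_. M"])
      show "(\<lambda>s. v s (z (r n) (max 0 (s - h (r n))))) integrable_on {0..t}" for n
        by (intro integrable_continuous_real
            continuous_on_delayed[OF v lipschitz_on_continuous_on[OF lip] h(1)])
      show "(\<lambda>n. v s (z (r n) (max 0 (s - h (r n))))) \<longlonglongrightarrow> v s (y s)" if "s \<in> {0..t}" for s
        using that t by (intro continuous_on_tendsto_compose[OF vc limd]) auto
    qed (auto simp: M)
    then have "(\<lambda>n. z (r n) t) \<longlonglongrightarrow> x + integral {0..t} (\<lambda>s. v s (y s))"
      unfolding zeq[OF t] by (intro tendsto_intros)
    then show ?thesis using lim[OF t] LIMSEQ_unique by blast
  qed
  have "continuous_on {0..1} (\<lambda>s. (s, y s))" using y by (intro continuous_intros)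
  from continuous_on_compose2[OF v this] have c: "continuous_on {0..1} (\<lambda>s. v s (y s))" by simp
  show ?thesis
  proof (rule that[OF _ y])
    show "y 0 = x" using yeq[of 0] by simp
    fix t :: real assume t: "t \<in> {0..1}"
    have "((\<lambda>t. x + integral {0..t} (\<lambda>s. v s (y s))) has_vector_derivative v t (y t))
        (at t within {0..1})"
      using integral_has_vector_derivative[OF c t] by (auto intro!: derivative_eq_intros)
    then show "(y has_vector_derivative v t (y t)) (at t within {0..1})"
      by (rule has_vector_derivative_transform[OF t, rotated]) (use yeq in auto)
  qed
qed

section \<open>Optimal transport on a compact set\<close>

lemma integrable_continuous_compact:
  fixes h :: "'b::topological_space \<Rightarrow> 'c::{banach, second_countable_topology}"
  assumes "prob_space M" and f: "f \<in> borel_measurable M" and AE: "AE x in M. f x \<in> K"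
    and K: "compact K" and h: "continuous_on UNIV h"
  shows "integrable M (\<lambda>x. h (f x))"
proof -
  interpret prob_space M by fact
  have "compact (h ` K)"
    using K h by (meson compact_continuous_image continuous_on_subset subset_UNIV)
  then obtain b where b: "\<And>y. y \<in> K \<Longrightarrow> norm (h y) \<le> b"
    using compact_imp_bounded[of "h ` K"] by (auto simp: bounded_iff)
  have "(\<lambda>x. h (f x)) \<in> borel_measurable M"
    by (rule measurable_compose[OF f borel_measurable_continuous_onI[OF h]])
  moreover have "AE x in M. norm (h (f x)) \<le> b" using AE by eventually_elim (rule b)
  ultimately show ?thesis by (intro integrable_const_bound) auto
qed

lemma prob_measures_onD:
  assumes "\<mu> \<in> prob_measures_on \<Omega>"
  shows "prob_space \<mu>" "sets \<mu> = sets borel" "space \<mu> = UNIV" "AE x in \<mu>. x \<in> \<Omega>"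
proof -
  show p: "prob_space \<mu>" and s: "sets \<mu> = sets borel"
    using assms by (auto simp: prob_measures_on_def)
  show "space \<mu> = UNIV" using sets_eq_imp_space_eq[OF s] by simp
  interpret prob_space \<mu> by (rule p)
  have "prob \<Omega> = 1" using assms by (simp add: prob_measures_on_def emeasure_eq_measure)
  then show "AE x in \<mu>. x \<in> \<Omega>" by (rule AE_prob_1)
qed

text \<open>\<open>couplings\<close> does not demand total mass one; a coupling inherits it from its
  first marginal. Both marginals live on \<open>\<Omega>\<close>, so the coupling lives on a compact
  product, where continuous functions are bounded.\<close>

lemma couplingsD:
  assumes \<pi>: "\<pi> \<in> couplings \<mu> \<nu>" and \<mu>: "\<mu> \<in> prob_measures_on \<Omega>" and \<nu>: "\<nu> \<in> prob_measures_on \<Omega>"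
    and \<Omega>: "closed \<Omega>"
  shows "prob_space \<pi>" "sets \<pi> = sets borel" "distr \<pi> borel fst = \<mu>" "distr \<pi> borel snd = \<nu>"
    "fst \<in> borel_measurable \<pi>" "snd \<in> borel_measurable \<pi>"
    "AE z in \<pi>. z \<in> \<Omega> \<times> \<Omega>"
proof -
  show s: "sets \<pi> = sets borel" and m: "distr \<pi> borel fst = \<mu>" "distr \<pi> borel snd = \<nu>"
    using \<pi> by (auto simp: couplings_def)
  have "fst \<in> borel_measurable borel" "snd \<in> borel_measurable borel"
    by (auto intro!: borel_measurable_continuous_onI continuous_intros)
  then show b: "fst \<in> borel_measurable \<pi>" "snd \<in> borel_measurable \<pi>"
    by (simp_all only: measurable_cong_sets[OF s refl])
  show "prob_space \<pi>"
    using prob_space_distrD[OF b(1)] m prob_measures_onD[OF \<mu>] by simp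
  have \<Omega>b: "{x \<in> space borel. x \<in> \<Omega>} \<in> sets borel" using \<Omega> by simp
  have "AE z in \<pi>. fst z \<in> \<Omega>"
    using prob_measures_onD(4)[OF \<mu>] unfolding m(1)[symmetric] AE_distr_iff[OF b(1) \<Omega>b] .
  moreover have "AE z in \<pi>. snd z \<in> \<Omega>"
    using prob_measures_onD(4)[OF \<nu>] unfolding m(2)[symmetric] AE_distr_iff[OF b(2) \<Omega>b] .
  ultimately show "AE z in \<pi>. z \<in> \<Omega> \<times> \<Omega>" by eventually_elim auto
qed

lemma couplings_integrable:
  fixes h :: "'a::euclidean_space \<times> 'a \<Rightarrow> 'c::{banach, second_countable_topology}"
  assumes \<pi>: "\<pi> \<in> couplings \<mu> \<nu>" and \<mu>: "\<mu> \<in> prob_measures_on \<Omega>" and \<nu>: "\<nu> \<in> prob_measures_on \<Omega>"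
    and \<Omega>: "compact \<Omega>" and h: "continuous_on UNIV h"
  shows "integrable \<pi> h"
proof -
  note d = couplingsD[OF \<pi> \<mu> \<nu> compact_imp_closed[OF \<Omega>]]
  have "(\<lambda>z. z) \<in> borel_measurable \<pi>" using d(2) by (simp add: measurable_cong_sets[OF d(2) refl])
  then show ?thesis
    using integrable_continuous_compact[OF d(1) _ d(7) compact_Times[OF \<Omega> \<Omega>] h] by simp
qed

text \<open>A real-valued form of \<open>transport_cost\<close>, so that costs can be subtracted.
  The order \<open>snd z - fst z\<close> is the displacement of a particle starting at
  \<open>fst z\<close>, the vector that is compared with \<open>G (fst z)\<close> below.\<close>

definition quadratic_cost :: "('a::euclidean_space \<times> 'a) measure \<Rightarrow> real" where
  "quadratic_cost \<pi> = (\<integral>z. (norm (snd z - fst z))\<^sup>2 \<partial>\<pi>)"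

lemma transport_cost_eq:
  assumes "\<pi> \<in> couplings \<mu> \<nu>" "\<mu> \<in> prob_measures_on \<Omega>" "\<nu> \<in> prob_measures_on \<Omega>" "compact \<Omega>"
  shows "transport_cost \<pi> = ennreal (quadratic_cost \<pi>)"
proof -
  have "integrable \<pi> (\<lambda>z. (norm (snd z - fst z))\<^sup>2)"
    by (rule couplings_integrable[OF assms]) (auto intro!: continuous_intros)
  then show ?thesis
    unfolding transport_cost_def quadratic_cost_def
    by (subst nn_integral_eq_integral[symmetric])
      (auto simp: case_prod_unfold norm_minus_commute)
qed

lemma quadratic_cost_nonneg: "0 \<le> quadratic_cost \<pi>"
  by (simp add: quadratic_cost_def)

lemma wasserstein_nonneg: "0 \<le> wasserstein \<mu> \<nu>"
  by (simp add: wasserstein_def)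

lemma wasserstein_sq_le:
  assumes "\<pi> \<in> couplings \<mu> \<nu>" "\<mu> \<in> prob_measures_on \<Omega>" "\<nu> \<in> prob_measures_on \<Omega>" "compact \<Omega>"
  shows "(wasserstein \<mu> \<nu>)\<^sup>2 \<le> quadratic_cost \<pi>"
proof -
  have "enn2real (INF \<pi>\<in>couplings \<mu> \<nu>. transport_cost \<pi>) \<le> enn2real (ennreal (quadratic_cost \<pi>))"
    using INF_lower[OF assms(1), of transport_cost]
    by (intro enn2real_mono) (auto simp: transport_cost_eq[OF assms])
  then show ?thesis by (simp add: wasserstein_def quadratic_cost_nonneg)
qed

text \<open>A coupling has to be exhibited: over the empty set the infimum is \<open>top\<close>,
  which \<open>enn2real\<close> turns into 0, and a positive lower bound would then be
  false.\<close>

lemma wasserstein_sq_ge: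
  assumes \<pi>: "\<pi> \<in> couplings \<mu> \<nu>" and \<mu>: "\<mu> \<in> prob_measures_on \<Omega>" and \<nu>: "\<nu> \<in> prob_measures_on \<Omega>"
    and \<Omega>: "compact \<Omega>" and c: "\<And>\<pi>. \<pi> \<in> couplings \<mu> \<nu> \<Longrightarrow> c \<le> quadratic_cost \<pi>"
  shows "c \<le> (wasserstein \<mu> \<nu>)\<^sup>2"
proof -
  have "ennreal c \<le> (INF \<pi>\<in>couplings \<mu> \<nu>. transport_cost \<pi>)"
    using c by (intro INF_greatest) (simp add: transport_cost_eq[OF _ \<mu> \<nu> \<Omega>] ennreal_leI)
  moreover have "(INF \<pi>\<in>couplings \<mu> \<nu>. transport_cost \<pi>) < top"
    using INF_lower[OF \<pi>, of transport_cost]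
    by (simp add: transport_cost_eq[OF \<pi> \<mu> \<nu> \<Omega>] order_le_less_trans)
  ultimately have "enn2real (ennreal c) \<le> enn2real (INF \<pi>\<in>couplings \<mu> \<nu>. transport_cost \<pi>)"
    by (rule enn2real_mono)
  moreover have "c \<le> enn2real (ennreal c)" by (cases "0 \<le> c") (auto simp: ennreal_neg)
  ultimately show ?thesis by (simp add: wasserstein_def)
qed

lemma wasserstein_le_diameter:
  assumes \<mu>: "\<mu> \<in> prob_measures_on \<Omega>" and \<nu>: "\<nu> \<in> prob_measures_on \<Omega>" and \<Omega>: "compact \<Omega>"
  shows "wasserstein \<mu> \<nu> \<le> diameter \<Omega>"
proof (cases "couplings \<mu> \<nu> = {}")
  \<comment> \<open>The infimum is \<open>top\<close>, and \<open>enn2real\<close> makes the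
    distance 0.\<close>
  case True
  then show ?thesis
    by (simp add: wasserstein_def diameter_ge_0[OF compact_imp_bounded[OF \<Omega>]])
next
  case False
  then obtain \<pi> where \<pi>: "\<pi> \<in> couplings \<mu> \<nu>" by auto
  note d = couplingsD[OF \<pi> \<mu> \<nu> compact_imp_closed[OF \<Omega>]]
  interpret prob_space \<pi> by (rule d)
  have "quadratic_cost \<pi> \<le> (\<integral>z. (diameter \<Omega>)\<^sup>2 \<partial>\<pi>)"
    unfolding quadratic_cost_def
  proof (rule integral_mono_AE)
    show "integrable \<pi> (\<lambda>z. (norm (snd z - fst z))\<^sup>2)"
      by (rule couplings_integrable[OF \<pi> \<mu> \<nu> \<Omega>]) (auto intro!: continuous_intros)
    show "AE z in \<pi>. (norm (snd z - fst z))\<^sup>2 \<le> (diameter \<Omega>)\<^sup>2"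
      using d(7)
    proof eventually_elim
      case (elim z)
      then have "dist (snd z) (fst z) \<le> diameter \<Omega>"
        by (intro diameter_bounded_bound compact_imp_bounded \<Omega>) auto
      then show ?case by (intro power_mono) (auto simp: dist_norm)
    qed
  qed simp
  also have "\<dots> = (diameter \<Omega>)\<^sup>2" by (simp add: prob_space)
  finally have "(wasserstein \<mu> \<nu>)\<^sup>2 \<le> (diameter \<Omega>)\<^sup>2"
    using wasserstein_sq_le[OF \<pi> \<mu> \<nu> \<Omega>] by simp
  then show ?thesis
    by (rule power2_le_imp_le) (rule diameter_ge_0[OF compact_imp_bounded[OF \<Omega>]])
qed

lemma wasserstein_commute:
  fixes \<mu> \<nu> :: "'a::euclidean_space measure"
  shows "wasserstein \<mu> \<nu> = wasserstein \<nu> \<mu>"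
proof -
  have swap: "prod.swap \<in> borel_measurable (borel :: ('a \<times> 'a) measure)"
    unfolding prod.swap_def by (auto intro!: borel_measurable_continuous_onI continuous_intros)
  have fs: "fst \<in> borel_measurable (borel :: ('a \<times> 'a) measure)"
    "snd \<in> borel_measurable (borel :: ('a \<times> 'a) measure)"
    by (auto intro!: borel_measurable_continuous_onI continuous_intros)
  have "\<exists>\<pi>'\<in>couplings \<nu> \<mu>. transport_cost \<pi>' \<le> transport_cost \<pi>" if \<pi>: "\<pi> \<in> couplings \<mu> \<nu>"
    for \<mu> \<nu> :: "'a measure" and \<pi>
  proof
    have s: "sets \<pi> = sets borel" and m: "distr \<pi> borel fst = \<mu>" "distr \<pi> borel snd = \<nu>"
      using \<pi> by (auto simp: couplings_def)
    have sw: "prod.swap \<in> borel_measurable \<pi>" using swap by (simp only: measurable_cong_sets[OF s refl])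
    show "distr \<pi> borel prod.swap \<in> couplings \<nu> \<mu>"
      using m by (simp add: couplings_def distr_distr[OF _ sw] fs o_def)
    have "(\<lambda>z::'a \<times> 'a. ennreal ((norm (fst z - snd z))\<^sup>2)) \<in> borel_measurable borel"
      using fs by measurable
    then show "transport_cost (distr \<pi> borel prod.swap) \<le> transport_cost \<pi>"
      unfolding transport_cost_def case_prod_unfold
      by (subst nn_integral_distr[OF sw]) (auto simp: norm_minus_commute)
  qed
  then have "(INF \<pi>\<in>couplings \<nu> \<mu>. transport_cost \<pi>) \<le> (INF \<pi>\<in>couplings \<mu> \<nu>. transport_cost \<pi>)"
    for \<mu> \<nu> :: "'a measure"
    by (intro INF_mono) auto
  then show ?thesis unfolding wasserstein_def by (metis antisym)
qed

lemma distr_pair_coupling: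
  fixes p q :: "'a::euclidean_space \<Rightarrow> 'a"
  assumes "sets M = sets borel" "p \<in> borel_measurable borel" "q \<in> borel_measurable borel"
  shows "distr M borel (\<lambda>x. (p x, q x)) \<in> couplings (distr M borel p) (distr M borel q)"
proof -
  have m: "p \<in> borel_measurable M" "q \<in> borel_measurable M"
    using assms by (simp_all add: measurable_cong_sets[OF assms(1) refl])
  then have "(\<lambda>x. (p x, q x)) \<in> borel_measurable M" by measurable
  moreover have "fst \<in> borel_measurable (borel :: ('a \<times> 'a) measure)"
    "snd \<in> borel_measurable (borel :: ('a \<times> 'a) measure)"
    by (auto intro!: borel_measurable_continuous_onI continuous_intros)
  ultimately show ?thesis by (simp add: couplings_def distr_distr o_def)
qed

section \<open>Gradient fields as approximate transport displacements\<close>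

text \<open>Mean value inequality for \<open>f\<close> minus its linearisation at \<open>x\<close>:
  along the segment the gradient differs from \<open>G x\<close> by at most
  \<open>K * norm (y - x)\<close>. The sharp constant \<open>K / 2\<close> is not pursued.\<close>

lemma gradient_remainder:
  fixes f :: "'a::euclidean_space \<Rightarrow> real"
  assumes G: "\<And>x. GDERIV f x :> G x" and K: "\<And>x y. norm (G x - G y) \<le> K * norm (x - y)"
  shows "\<bar>f y - f x - G x \<bullet> (y - x)\<bar> \<le> K * (norm (y - x))\<^sup>2"
proof -
  \<comment> \<open>The sign of \<open>K\<close> follows from its Lipschitz property as soon as
    there are two distinct points; for \<open>y = x\<close> both sides vanish.\<close>
  have "K \<ge> 0" if "y \<noteq> x"
    using order_trans[OF norm_ge_zero K[of y x]] that by (simp add: zero_le_mult_iff)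
  then have K0: "K * norm (z - x) \<le> K * norm (y - x)" if "z \<in> closed_segment x y" for z
    using segment_bound1[OF that] that by (cases "y = x") (auto simp: mult_left_mono norm_minus_commute)
  have "norm (f y - f x - (\<lambda>h. G x \<bullet> h) (y - x)) \<le> norm (y - x) * (K * norm (y - x))"
  proof (rule differentiable_bound_linearization[of x y "closed_segment x y" f "\<lambda>z h. G z \<bullet> h"])
    show "x + t *\<^sub>R (y - x) \<in> closed_segment x y" if "t \<in> {0..1}" for t
      using that by (auto simp: closed_segment_def algebra_simps intro!: exI[of _ t])
    show "(f has_derivative (\<lambda>h. G z \<bullet> h)) (at z within closed_segment x y)" for z
    proof -
      have "(\<lambda>h. G z \<bullet> h) = (\<lambda>h. h \<bullet> G z)" by (simp add: inner_commute)
      then show ?thesis using G[of z] unfolding gderiv_def by (metis has_derivative_at_withinI)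
    qed
    show "onorm ((\<lambda>h. G z \<bullet> h) - (\<lambda>h. G x \<bullet> h)) \<le> K * norm (y - x)"
      if "z \<in> closed_segment x y" for z
    proof (rule onorm_le)
      fix h
      have "norm (((\<lambda>h. G z \<bullet> h) - (\<lambda>h. G x \<bullet> h)) h) = \<bar>(G z - G x) \<bullet> h\<bar>"
        by (simp add: inner_diff_left)
      also have "\<dots> \<le> norm (G z - G x) * norm h" by (rule Cauchy_Schwarz_ineq2)
      also have "\<dots> \<le> K * norm (y - x) * norm h"
        using K[of z x] K0[OF that] by (intro mult_right_mono) auto
      finally show "norm (((\<lambda>h. G z \<bullet> h) - (\<lambda>h. G x \<bullet> h)) h) \<le> K * norm (y - x) * norm h" .
    qed
  qed simp
  then show ?thesis by (simp add: power2_eq_square mult_ac)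
qed

text \<open>Up to \<open>K\<close> times the quadratic cost, the mean squared deviation of the displacement
  from the gradient field \<open>G\<close> differs from the cost only by a term that depends on the marginals
  alone. This replaces Kantorovich duality.\<close>

lemma gradient_deviation:
  fixes f :: "'a::euclidean_space \<Rightarrow> real"
  assumes \<pi>: "\<pi> \<in> couplings \<mu> \<nu>" and \<mu>: "\<mu> \<in> prob_measures_on \<Omega>" and \<nu>: "\<nu> \<in> prob_measures_on \<Omega>"
    and \<Omega>: "compact \<Omega>"
    and G: "\<And>x. GDERIV f x :> G x" and K: "\<And>x y. norm (G x - G y) \<le> K * norm (x - y)"
  shows "\<bar>(\<integral>z. (norm (snd z - fst z - G (fst z)))\<^sup>2 \<partial>\<pi>) - quadratic_cost \<pi>
      - ((\<integral>x. (norm (G x))\<^sup>2 + 2 * f x \<partial>\<mu>) - (\<integral>y. 2 * f y \<partial>\<nu>))\<bar> \<le> 2 * K * quadratic_cost \<pi>"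
proof -
  note d = couplingsD[OF \<pi> \<mu> \<nu> compact_imp_closed[OF \<Omega>]]
  have "isCont f x" for x using G[of x] unfolding gderiv_def by (rule has_derivative_continuous)
  then have f: "continuous_on UNIV f" by (simp add: continuous_at_imp_continuous_on)
  have "(\<bar>K\<bar>)-lipschitz_on UNIV G"
    using order_trans[OF K mult_right_mono[OF abs_ge_self norm_ge_zero]]
    by (auto intro!: lipschitz_onI simp: dist_norm)
  then have c: "continuous_on UNIV G" by (rule lipschitz_on_continuous_on)
  note cc = continuous_on_compose2[OF f _ subset_UNIV] continuous_on_compose2[OF c _ subset_UNIV]
  note int = couplings_integrable[OF \<pi> \<mu> \<nu> \<Omega>]
  have i1: "integrable \<pi> (\<lambda>z. (norm (snd z - fst z - G (fst z)))\<^sup>2)"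
    and i2: "integrable \<pi> (\<lambda>z. (norm (snd z - fst z))\<^sup>2)"
    and i3: "integrable \<pi> (\<lambda>z. (norm (G (fst z)))\<^sup>2 + 2 * f (fst z))"
    and i4: "integrable \<pi> (\<lambda>z. 2 * f (snd z))"
    by (rule int, intro continuous_intros cc)+
  have e3: "(\<integral>x. (norm (G x))\<^sup>2 + 2 * f x \<partial>\<mu>) = (\<integral>z. (norm (G (fst z)))\<^sup>2 + 2 * f (fst z) \<partial>\<pi>)"
    unfolding d(3)[symmetric]
    by (rule integral_distr[OF d(5)]) (intro borel_measurable_continuous_onI continuous_intros cc)
  have e4: "(\<integral>y. 2 * f y \<partial>\<nu>) = (\<integral>z. 2 * f (snd z) \<partial>\<pi>)"
    unfolding d(4)[symmetric]
    by (rule integral_distr[OF d(6)]) (intro borel_measurable_continuous_onI continuous_intros cc)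
  \<comment> \<open>Apart from the cost itself, only the cross term
    \<open>G (fst z) \<bullet> (snd z - fst z)\<close> of the squared deviation couples the two
    marginals. Replacing it by \<open>f (snd z) - f (fst z)\<close> leaves marginal terms only, and
    \<open>?q\<close> is twice the error of this replacement.\<close>
  let ?q = "\<lambda>z. (norm (snd z - fst z - G (fst z)))\<^sup>2 - (norm (snd z - fst z))\<^sup>2
      - (((norm (G (fst z)))\<^sup>2 + 2 * f (fst z)) - 2 * f (snd z))"
  have "\<bar>\<integral>z. ?q z \<partial>\<pi>\<bar> \<le> (\<integral>z. 2 * K * (norm (snd z - fst z))\<^sup>2 \<partial>\<pi>)"
  proof -
    have "\<bar>?q z\<bar> \<le> 2 * K * (norm (snd z - fst z))\<^sup>2" for z
    proof -
      have "(norm (snd z - fst z - G (fst z)))\<^sup>2 = (norm (snd z - fst z))\<^sup>2 + (norm (G (fst z)))\<^sup>2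
          - 2 * (G (fst z) \<bullet> (snd z - fst z))"
        by (simp add: power2_norm_eq_inner inner_diff_left inner_diff_right inner_commute)
      then have "?q z = 2 * (f (snd z) - f (fst z) - G (fst z) \<bullet> (snd z - fst z))" by simp
      then show ?thesis using gradient_remainder[OF G K, of "snd z" "fst z"] by (simp add: abs_mult)
    qed
    moreover have "integrable \<pi> ?q" using i1 i2 i3 i4 by (intro Bochner_Integration.integrable_diff)
    moreover have "integrable \<pi> (\<lambda>z. 2 * K * (norm (snd z - fst z))\<^sup>2)" using i2 by simp
    ultimately show ?thesis using Bochner_Integration.integral_norm_bound_integral[of \<pi> ?q "\<lambda>z. 2 * K * (norm (snd z - fst z))\<^sup>2"]
      by simp
  qed
  moreover have "(\<integral>z. ?q z \<partial>\<pi>) = (\<integral>z. (norm (snd z - fst z - G (fst z)))\<^sup>2 \<partial>\<pi>) - quadratic_cost \<pi>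
      - ((\<integral>x. (norm (G x))\<^sup>2 + 2 * f x \<partial>\<mu>) - (\<integral>y. 2 * f y \<partial>\<nu>))"
    unfolding quadratic_cost_def e3 e4 using i1 i2 i3 i4
    by (simp only: Bochner_Integration.integral_diff Bochner_Integration.integrable_diff)
  ultimately show ?thesis by (simp add: quadratic_cost_def)
qed

section \<open>The L2 norm and its triangle inequality\<close>

lemma L2_norm_sq: "(L2_norm M f)\<^sup>2 = (\<integral>x. (norm (f x))\<^sup>2 \<partial>M)"
  by (simp add: L2_norm_def)

lemma L2_norm_nonneg: "0 \<le> L2_norm M f"
  by (simp add: L2_norm_def)

lemma L2_norm_minus: "L2_norm M (\<lambda>x. f x - g x) = L2_norm M (\<lambda>x. g x - f x)"
  by (simp add: L2_norm_def norm_minus_commute)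

lemma L2_norm_bound:
  assumes "prob_space M" and c: "\<And>x. norm (f x) \<le> c"
  shows "L2_norm M f \<le> c"
proof -
  interpret prob_space M by fact
  have c0: "0 \<le> c" using c norm_ge_zero order_trans by blast
  have "(\<integral>x. (norm (f x))\<^sup>2 \<partial>M) \<le> c\<^sup>2"
  proof (cases "integrable M (\<lambda>x. (norm (f x))\<^sup>2)")
    case True
    then have "(\<integral>x. (norm (f x))\<^sup>2 \<partial>M) \<le> (\<integral>x. c\<^sup>2 \<partial>M)"
      by (intro integral_mono power_mono c) auto
    then show ?thesis by (simp add: prob_space)
  next
    \<comment> \<open>The Bochner integral of a non-integrable function is 0 by convention.\<close>
    case False
    then show ?thesis by (simp add: not_integrable_integral_eq)
  qed
  then show ?thesis unfolding L2_norm_def using c0 by (simp add: real_le_lsqrt)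
qed

text \<open>Young's inequality with a free weight, from the nonnegative square of
  \<open>s *\<^sub>R a - b\<close>. Optimising \<open>s\<close> after integration gives the triangle
  inequality in L2.\<close>

lemma young_norm_add:
  fixes a b :: "'a::euclidean_space"
  assumes "0 < s"
  shows "(norm (a + b))\<^sup>2 \<le> (1 + s) * (norm a)\<^sup>2 + (1 + 1 / s) * (norm b)\<^sup>2"
proof -
  have "0 \<le> (norm (s *\<^sub>R a - b))\<^sup>2 / s" using assms by simp
  also have "\<dots> = s * (norm a)\<^sup>2 - 2 * (a \<bullet> b) + (norm b)\<^sup>2 / s"
    using assms
    by (simp add: power2_norm_eq_inner inner_diff_left inner_diff_right inner_commute field_simps)
  finally show ?thesis
    by (simp add: power2_norm_eq_inner inner_add_left inner_add_right inner_commute algebra_simps)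
qed

text \<open>Guards against the default value of the integral: outside this class
  \<open>L2_norm\<close> may be 0 for a large function, and the triangle inequality may
  fail.\<close>

definition sq_integrable :: "'b measure \<Rightarrow> ('b \<Rightarrow> 'a::euclidean_space) \<Rightarrow> bool" where
  "sq_integrable M f \<longleftrightarrow> f \<in> borel_measurable M \<and> integrable M (\<lambda>x. (norm (f x))\<^sup>2)"

lemma sq_integrable_bounded:
  assumes "prob_space M" "f \<in> borel_measurable M" and c: "AE x in M. norm (f x) \<le> c"
  shows "sq_integrable M f"
proof -
  interpret prob_space M by fact
  have "AE x in M. norm ((norm (f x))\<^sup>2) \<le> c\<^sup>2"
    using c by eventually_elim (simp add: power_mono)
  moreover have "(\<lambda>x. (norm (f x))\<^sup>2) \<in> borel_measurable M" using assms(2) by measurable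
  ultimately have "integrable M (\<lambda>x. (norm (f x))\<^sup>2)" by (rule integrable_const_bound)
  then show ?thesis using assms(2) by (simp add: sq_integrable_def)
qed

lemma sq_integrable_add:
  assumes "sq_integrable M f" "sq_integrable M g"
  shows "sq_integrable M (\<lambda>x. f x + g x)"
proof -
  have f: "f \<in> borel_measurable M" "integrable M (\<lambda>x. (norm (f x))\<^sup>2)"
    and g: "g \<in> borel_measurable M" "integrable M (\<lambda>x. (norm (g x))\<^sup>2)"
    using assms by (auto simp: sq_integrable_def)
  have i: "integrable M (\<lambda>x. 2 * (norm (f x))\<^sup>2 + 2 * (norm (g x))\<^sup>2)" using f g by simp
  have le: "(norm (f x + g x))\<^sup>2 \<le> 2 * (norm (f x))\<^sup>2 + 2 * (norm (g x))\<^sup>2" for x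
    using young_norm_add[of 1 "f x" "g x"] by simp
  have m: "(\<lambda>x. f x + g x) \<in> borel_measurable M" using f g by measurable
  then have "(\<lambda>x. (norm (f x + g x))\<^sup>2) \<in> borel_measurable M" by measurable
  then have "integrable M (\<lambda>x. (norm (f x + g x))\<^sup>2)"
    using order_trans[OF le abs_ge_self] by (intro Bochner_Integration.integrable_bound[OF i]) auto
  then show ?thesis using m by (simp add: sq_integrable_def)
qed

lemma sq_integrable_diff:
  assumes f: "sq_integrable M f" and g: "sq_integrable M g"
  shows "sq_integrable M (\<lambda>x. f x - g x)"
proof -
  have "sq_integrable M (\<lambda>x. - g x)" using g by (simp add: sq_integrable_def)
  from sq_integrable_add[OF f this] show ?thesis by simp
qed

lemma L2_norm_triangle:
  fixes f g :: "'a::euclidean_space \<Rightarrow> 'a"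
  assumes f: "sq_integrable M f" and g: "sq_integrable M g"
  shows "L2_norm M (\<lambda>x. f x + g x) \<le> L2_norm M f + L2_norm M g"
proof (rule field_le_epsilon)
  fix e :: real assume e: "0 < e"
  \<comment> \<open>The two halves of \<open>e\<close> make \<open>a\<close> and \<open>b\<close>
    positive, so that the optimal weight \<open>b / a\<close> is available; with it the Young bound
    sums up to exactly \<open>(a + b)\<^sup>2\<close>.\<close>
  define a b where "a = L2_norm M f + e / 2" and "b = L2_norm M g + e / 2"
  have ab: "0 < a" "0 < b" "(L2_norm M f)\<^sup>2 \<le> a\<^sup>2" "(L2_norm M g)\<^sup>2 \<le> b\<^sup>2"
    using e L2_norm_nonneg[of M f] L2_norm_nonneg[of M g]
    by (auto simp: a_def b_def intro!: power_mono)
  have i: "integrable M (\<lambda>x. (norm (f x))\<^sup>2)" "integrable M (\<lambda>x. (norm (g x))\<^sup>2)"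
    using f g by (auto simp: sq_integrable_def)
  have "(\<integral>x. (norm (f x + g x))\<^sup>2 \<partial>M)
      \<le> (\<integral>x. (1 + b / a) * (norm (f x))\<^sup>2 + (1 + 1 / (b / a)) * (norm (g x))\<^sup>2 \<partial>M)"
  proof (rule integral_mono)
    show "integrable M (\<lambda>x. (1 + b / a) * (norm (f x))\<^sup>2 + (1 + 1 / (b / a)) * (norm (g x))\<^sup>2)"
      using i by simp
    show "integrable M (\<lambda>x. (norm (f x + g x))\<^sup>2)"
      using sq_integrable_add[OF f g] by (simp add: sq_integrable_def)
    show "(norm (f x + g x))\<^sup>2 \<le> (1 + b / a) * (norm (f x))\<^sup>2 + (1 + 1 / (b / a)) * (norm (g x))\<^sup>2"
      for x
      using ab by (intro young_norm_add) simp
  qed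
  also have "\<dots> = (1 + b / a) * (L2_norm M f)\<^sup>2 + (1 + a / b) * (L2_norm M g)\<^sup>2"
    using i by (simp add: L2_norm_sq)
  also have "\<dots> \<le> (1 + b / a) * a\<^sup>2 + (1 + a / b) * b\<^sup>2"
    using ab by (intro add_mono mult_left_mono) auto
  also have "\<dots> = (a + b)\<^sup>2"
    using ab by (simp add: power2_eq_square field_simps)
  finally have "L2_norm M (\<lambda>x. f x + g x) \<le> a + b"
    unfolding L2_norm_def using ab by (intro real_le_lsqrt) auto
  then show "L2_norm M (\<lambda>x. f x + g x) \<le> L2_norm M f + L2_norm M g + e"
    by (simp add: a_def b_def)
qed

lemma L2_norm_diff_le:
  fixes f g :: "'a::euclidean_space \<Rightarrow> 'a"
  assumes f: "sq_integrable M f" and g: "sq_integrable M g"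
  shows "L2_norm M (\<lambda>x. f x - g x) \<le> L2_norm M f + L2_norm M g"
proof -
  have "sq_integrable M (\<lambda>x. - g x)" using g by (simp add: sq_integrable_def)
  from L2_norm_triangle[OF f this] show ?thesis by (simp add: L2_norm_def)
qed

lemma L2_norm_abs_diff_le:
  fixes f g :: "'a::euclidean_space \<Rightarrow> 'a"
  assumes f: "sq_integrable M f" and g: "sq_integrable M g"
  shows "\<bar>L2_norm M f - L2_norm M g\<bar> \<le> L2_norm M (\<lambda>x. f x - g x)"
  using L2_norm_triangle[OF g sq_integrable_diff[OF f g]]
    L2_norm_triangle[OF f sq_integrable_diff[OF g f]] L2_norm_minus[of M f g]
  by simp

section \<open>Distances and optimal maps between push-forwards of one measure\<close>

lemma integral_distr_pair:
  fixes p q :: "'a::euclidean_space \<Rightarrow> 'a"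
  assumes "sets M = sets borel" "p \<in> borel_measurable borel" "q \<in> borel_measurable borel"
    and h: "h \<in> borel_measurable borel"
  shows "(\<integral>z. h z \<partial>distr M borel (\<lambda>x. (p x, q x))) = (\<integral>x. (h (p x, q x) :: real) \<partial>M)"
proof -
  have "p \<in> borel_measurable M" "q \<in> borel_measurable M"
    using assms by (simp_all add: measurable_cong_sets[OF assms(1) refl])
  then have "(\<lambda>x. (p x, q x)) \<in> borel_measurable M" by measurable
  then show ?thesis using h by (rule integral_distr)
qed

lemma borel_measurable_sq_dist:
  "(\<lambda>z::'a \<times> 'a. (norm (snd z - fst z))\<^sup>2) \<in> borel_measurable (borel :: ('a::euclidean_space \<times> 'a) measure)"
  by (intro borel_measurable_continuous_onI continuous_intros)

lemma quadratic_cost_distr_pair: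
  fixes p q :: "'a::euclidean_space \<Rightarrow> 'a"
  assumes "sets M = sets borel" "p \<in> borel_measurable borel" "q \<in> borel_measurable borel"
  shows "quadratic_cost (distr M borel (\<lambda>x. (p x, q x))) = (L2_norm M (\<lambda>x. q x - p x))\<^sup>2"
  by (simp add: quadratic_cost_def integral_distr_pair[OF assms borel_measurable_sq_dist] L2_norm_sq)

lemma borel_measurable_sq_deviation:
  fixes G :: "'a::euclidean_space \<Rightarrow> 'a"
  assumes "continuous_on UNIV G"
  shows "(\<lambda>z. (norm (snd z - fst z - G (fst z)))\<^sup>2) \<in> borel_measurable borel"
  by (intro borel_measurable_continuous_onI continuous_intros
      continuous_on_compose2[OF assms _ subset_UNIV])

lemma wasserstein_le_L2_norm:
  fixes p q :: "'a::euclidean_space \<Rightarrow> 'a"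
  assumes \<rho>: "sets \<rho> = sets borel" and pq: "p \<in> borel_measurable borel" "q \<in> borel_measurable borel"
    and \<mu>: "distr \<rho> borel p \<in> prob_measures_on \<Omega>" and \<nu>: "distr \<rho> borel q \<in> prob_measures_on \<Omega>"
    and \<Omega>: "compact \<Omega>"
  shows "wasserstein (distr \<rho> borel p) (distr \<rho> borel q) \<le> L2_norm \<rho> (\<lambda>x. p x - q x)"
proof -
  have "(wasserstein (distr \<rho> borel p) (distr \<rho> borel q))\<^sup>2 \<le> (L2_norm \<rho> (\<lambda>x. p x - q x))\<^sup>2"
    using wasserstein_sq_le[OF distr_pair_coupling[OF \<rho> pq] \<mu> \<nu> \<Omega>]
    by (simp add: quadratic_cost_distr_pair[OF \<rho> pq] L2_norm_minus[of _ p q])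
  then show ?thesis by (rule power2_le_imp_le) (rule L2_norm_nonneg)
qed

text \<open>The coupling by \<open>(p, q)\<close> nearly follows the gradient \<open>G\<close>, and
  its competitors have the same marginals, so the marginal term of \<open>gradient_deviation\<close>
  cancels. A competitor has nonnegative deviation and the given coupling at most
  \<open>\<epsilon>\<^sup>2\<close>, which bounds the cost of every competitor from below. No
  smallness of \<open>K\<close> is required, because the error \<open>4 * K\<close> times the norm
  stays on the right.\<close>

lemma L2_norm_le_wasserstein:
  fixes p q :: "'a::euclidean_space \<Rightarrow> 'a"
  assumes \<rho>: "prob_space \<rho>" "sets \<rho> = sets borel"
    and pq: "p \<in> borel_measurable borel" "q \<in> borel_measurable borel"
    and \<mu>: "distr \<rho> borel p \<in> prob_measures_on \<Omega>" and \<nu>: "distr \<rho> borel q \<in> prob_measures_on \<Omega>"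
    and \<Omega>: "compact \<Omega>"
    and G: "\<And>x. GDERIV f x :> G x" and K: "\<And>x y. norm (G x - G y) \<le> K * norm (x - y)" "0 \<le> K"
    and \<epsilon>: "\<And>x. norm (q x - p x - G (p x)) \<le> \<epsilon>"
  shows "L2_norm \<rho> (\<lambda>x. p x - q x)
    \<le> wasserstein (distr \<rho> borel p) (distr \<rho> borel q) + \<epsilon> + 4 * K * L2_norm \<rho> (\<lambda>x. p x - q x)"
proof -
  define \<Phi> W where "\<Phi> = L2_norm \<rho> (\<lambda>x. p x - q x)"
    and "W = wasserstein (distr \<rho> borel p) (distr \<rho> borel q)"
  define \<pi>' where "\<pi>' = distr \<rho> borel (\<lambda>x. (p x, q x))"
  have \<pi>': "\<pi>' \<in> couplings (distr \<rho> borel p) (distr \<rho> borel q)"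
    unfolding \<pi>'_def by (rule distr_pair_coupling[OF \<rho>(2) pq])
  have "K-lipschitz_on UNIV G" using K by (auto intro!: lipschitz_onI simp: dist_norm)
  then have c: "continuous_on UNIV G" by (rule lipschitz_on_continuous_on)
  have c': "quadratic_cost \<pi>' = \<Phi>\<^sup>2"
    by (simp add: \<pi>'_def quadratic_cost_distr_pair[OF \<rho>(2) pq] \<Phi>_def L2_norm_minus[of _ p q])
  have "(\<integral>z. (norm (snd z - fst z - G (fst z)))\<^sup>2 \<partial>\<pi>') = (L2_norm \<rho> (\<lambda>x. q x - p x - G (p x)))\<^sup>2"
    by (simp add: \<pi>'_def integral_distr_pair[OF \<rho>(2) pq borel_measurable_sq_deviation[OF c]] L2_norm_sq)
  also have "\<dots> \<le> \<epsilon>\<^sup>2"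
    using L2_norm_bound[OF \<rho>(1), of "\<lambda>x. q x - p x - G (p x)", OF \<epsilon>] L2_norm_nonneg by (rule power_mono)
  finally have R': "(\<integral>z. (norm (snd z - fst z - G (fst z)))\<^sup>2 \<partial>\<pi>') \<le> \<epsilon>\<^sup>2" .
  have "((1 - 2 * K) * \<Phi>\<^sup>2 - \<epsilon>\<^sup>2) / (1 + 2 * K) \<le> W\<^sup>2"
    unfolding W_def
  proof (rule wasserstein_sq_ge[OF \<pi>' \<mu> \<nu> \<Omega>])
    fix \<pi> assume \<pi>: "\<pi> \<in> couplings (distr \<rho> borel p) (distr \<rho> borel q)"
    have "0 \<le> (\<integral>z. (norm (snd z - fst z - G (fst z)))\<^sup>2 \<partial>\<pi>)" by simp
    with gradient_deviation[OF \<pi> \<mu> \<nu> \<Omega> G K(1)] gradient_deviation[OF \<pi>' \<mu> \<nu> \<Omega> G K(1)] R'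
    have "\<Phi>\<^sup>2 - 2 * K * \<Phi>\<^sup>2 - \<epsilon>\<^sup>2 \<le> quadratic_cost \<pi> + 2 * K * quadratic_cost \<pi>"
      unfolding c' abs_le_iff by linarith
    then show "((1 - 2 * K) * \<Phi>\<^sup>2 - \<epsilon>\<^sup>2) / (1 + 2 * K) \<le> quadratic_cost \<pi>"
      using K(2) by (simp add: field_simps)
  qed
  then have "(1 - 2 * K) * \<Phi>\<^sup>2 - \<epsilon>\<^sup>2 \<le> W\<^sup>2 + 2 * K * W\<^sup>2"
    using K(2) by (simp add: field_simps)
  moreover have W: "0 \<le> W" "W \<le> \<Phi>"
    unfolding W_def \<Phi>_def by (rule wasserstein_nonneg, rule wasserstein_le_L2_norm[OF \<rho>(2) pq \<mu> \<nu> \<Omega>])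
  \<comment> \<open>The trivial bound of \<open>W\<close> by \<open>\<Phi>\<close> merges the two
    losses of \<open>2 * K\<close> into \<open>4 * K\<close>.\<close>
  then have "2 * K * W\<^sup>2 \<le> 2 * K * \<Phi>\<^sup>2" using K(2) by (intro mult_left_mono power_mono) auto
  ultimately have main: "\<Phi>\<^sup>2 \<le> W\<^sup>2 + 4 * K * \<Phi>\<^sup>2 + \<epsilon>\<^sup>2" by (simp add: algebra_simps)
  have \<epsilon>0: "0 \<le> \<epsilon>" using \<epsilon> norm_ge_zero order_trans by blast
  \<comment> \<open>Taking roots termwise would turn \<open>K\<close> into its square root. Instead
    \<open>\<Phi>\<^sup>2 - W\<^sup>2\<close> is factored and bounded below by
    \<open>(\<Phi> - W) * \<Phi>\<close>; one factor \<open>\<Phi>\<close> is divided out and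
    \<open>K\<close> stays of first order.\<close>
  have "\<Phi> \<le> W + (\<epsilon> + 4 * K * \<Phi>)"
  proof (rule ccontr)
    assume "\<not> ?thesis"
    then have less: "\<epsilon> + 4 * K * \<Phi> < \<Phi> - W" by simp
    have \<Phi>0: "0 \<le> \<Phi>" using W by simp
    have "\<epsilon> < \<Phi>" using less W K(2) \<Phi>0 mult_nonneg_nonneg[of "4 * K" \<Phi>] by linarith
    then have "\<epsilon>\<^sup>2 + 4 * K * \<Phi>\<^sup>2 \<le> (\<epsilon> + 4 * K * \<Phi>) * \<Phi>"
      using mult_left_mono[OF less_imp_le[OF \<open>\<epsilon> < \<Phi>\<close>] \<epsilon>0]
      by (simp add: power2_eq_square algebra_simps)
    also have "\<dots> < (\<Phi> - W) * \<Phi>" using less \<open>\<epsilon> < \<Phi>\<close> \<epsilon>0 by (intro mult_strict_right_mono) auto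
    also have "\<dots> \<le> (\<Phi> - W) * (\<Phi> + W)" using W by (intro mult_left_mono) auto
    also have "\<dots> = \<Phi>\<^sup>2 - W\<^sup>2" by (simp add: power2_eq_square algebra_simps)
    finally show False using main by simp
  qed
  then show ?thesis by (simp add: \<Phi>_def W_def)
qed

text \<open>The couplings by \<open>T\<close> and by \<open>p\<close> have the same marginals, and
  the first costs no more than the second, which costs at most \<open>m\<^sup>2\<close>. Cancelling
  the marginal term bounds the squared deviation of \<open>T\<close> by
  \<open>e\<^sup>2 + 4 * (K * m\<^sup>2)\<close>. For \<open>K\<close> and \<open>m\<close> of order
  \<open>t\<close>, the root is the origin of the exponent 3/2.\<close>

lemma optimal_map_deviation:
  fixes p T :: "'a::euclidean_space \<Rightarrow> 'a"
  assumes \<rho>: "\<rho> \<in> prob_measures_on \<Omega>" and \<mu>: "distr \<rho> borel p \<in> prob_measures_on \<Omega>"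
    and \<Omega>: "compact \<Omega>" and p: "p \<in> borel_measurable borel"
    and T: "optimal_map \<rho> (distr \<rho> borel p) T"
    and G: "\<And>x. GDERIV f x :> G x" and K: "\<And>x y. norm (G x - G y) \<le> K * norm (x - y)" "0 \<le> K"
    and m: "\<And>x. norm (p x - x) \<le> m" and e: "\<And>x. norm (p x - x - G x) \<le> e"
  shows "L2_norm \<rho> (\<lambda>x. T x - x - G x) \<le> e + 2 * sqrt K * m"
proof -
  note l = prob_measures_onD[OF \<rho>]
  have idb: "(\<lambda>x. x) \<in> borel_measurable (borel :: 'a measure)" by simp
  have Tb: "T \<in> borel_measurable borel" using T by (simp add: optimal_map_def)
  have id: "distr \<rho> borel (\<lambda>x. x) = \<rho>" using l by (simp add: distr_id2)
  define \<pi> \<pi>' where "\<pi> = distr \<rho> borel (\<lambda>x. (x, T x))" and "\<pi>' = distr \<rho> borel (\<lambda>x. (x, p x))"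
  have \<pi>: "\<pi> \<in> couplings \<rho> (distr \<rho> borel p)"
    and opt: "transport_cost \<pi> = (INF \<pi>\<in>couplings \<rho> (distr \<rho> borel p). transport_cost \<pi>)"
    using T by (auto simp: optimal_map_def optimal_coupling_def \<pi>_def)
  have \<pi>': "\<pi>' \<in> couplings \<rho> (distr \<rho> borel p)"
    unfolding \<pi>'_def using distr_pair_coupling[OF l(2) idb p] by (simp add: id)
  have "transport_cost \<pi> \<le> transport_cost \<pi>'" unfolding opt using \<pi>' by (rule INF_lower)
  then have cc: "quadratic_cost \<pi> \<le> quadratic_cost \<pi>'"
    unfolding transport_cost_eq[OF \<pi> \<rho> \<mu> \<Omega>] transport_cost_eq[OF \<pi>' \<rho> \<mu> \<Omega>]
    by (simp add: ennreal_le_iff quadratic_cost_nonneg)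
  have "K-lipschitz_on UNIV G" using K by (auto intro!: lipschitz_onI simp: dist_norm)
  then have c: "continuous_on UNIV G" by (rule lipschitz_on_continuous_on)
  have m0: "0 \<le> m" and e0: "0 \<le> e" using m e norm_ge_zero order_trans by blast+
  have "quadratic_cost \<pi>' = (L2_norm \<rho> (\<lambda>x. p x - x))\<^sup>2"
    by (simp add: \<pi>'_def quadratic_cost_distr_pair[OF l(2) idb p])
  also have "\<dots> \<le> m\<^sup>2"
    using L2_norm_bound[OF l(1), of "\<lambda>x. p x - x", OF m] L2_norm_nonneg by (rule power_mono)
  finally have cm: "quadratic_cost \<pi>' \<le> m\<^sup>2" .
  have "(\<integral>z. (norm (snd z - fst z - G (fst z)))\<^sup>2 \<partial>\<pi>') = (L2_norm \<rho> (\<lambda>x. p x - x - G x))\<^sup>2"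
    by (simp add: \<pi>'_def integral_distr_pair[OF l(2) idb p borel_measurable_sq_deviation[OF c]] L2_norm_sq)
  also have "\<dots> \<le> e\<^sup>2"
    using L2_norm_bound[OF l(1), of "\<lambda>x. p x - x - G x", OF e] L2_norm_nonneg by (rule power_mono)
  finally have R': "(\<integral>z. (norm (snd z - fst z - G (fst z)))\<^sup>2 \<partial>\<pi>') \<le> e\<^sup>2" .
  have R: "(\<integral>z. (norm (snd z - fst z - G (fst z)))\<^sup>2 \<partial>\<pi>) = (L2_norm \<rho> (\<lambda>x. T x - x - G x))\<^sup>2"
    by (simp add: \<pi>_def integral_distr_pair[OF l(2) idb Tb borel_measurable_sq_deviation[OF c]] L2_norm_sq)
  have "2 * K * quadratic_cost \<pi> \<le> 2 * K * quadratic_cost \<pi>'" "2 * K * quadratic_cost \<pi>' \<le> 2 * K * m\<^sup>2"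
    using K(2) cc cm by (auto intro!: mult_left_mono)
  with gradient_deviation[OF \<pi> \<rho> \<mu> \<Omega> G K(1)] gradient_deviation[OF \<pi>' \<rho> \<mu> \<Omega> G K(1)] R' cc
  have "(L2_norm \<rho> (\<lambda>x. T x - x - G x))\<^sup>2 \<le> e\<^sup>2 + 4 * (K * m\<^sup>2)"
    unfolding R abs_le_iff by linarith
  also have "\<dots> \<le> (e + 2 * sqrt K * m)\<^sup>2"
  proof -
    have "(e + 2 * sqrt K * m)\<^sup>2 = e\<^sup>2 + 4 * (K * m\<^sup>2) + 4 * (e * (sqrt K * m))"
      using K(2) by (simp add: power2_sum power_mult_distrib)
    moreover have "0 \<le> e * (sqrt K * m)" using K(2) m0 e0 by simp
    ultimately show ?thesis by simp
  qed
  finally show ?thesis by (rule power2_le_imp_le) (use m0 e0 K(2) in auto)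
qed

section \<open>Geodesics and the induced distance\<close>

lemma has_velocity_subset:
  "has_velocity A I \<gamma> t w \<Longrightarrow> J \<subseteq> I \<Longrightarrow> has_velocity A J \<gamma> t w"
  by (auto simp: has_velocity_def intro: tendsto_within_subset has_vector_derivative_within_subset)

text \<open>In charts around the point this is uniqueness of derivatives, for which the interval
  must not be degenerate; on all other charts both vectors are 0 by the convention in
  \<open>tangent_space\<close>.\<close>

lemma velocity_eq:
  assumes v: "has_velocity A {a..b} \<gamma> t v" and ab: "a < b" "t \<in> {a..b}"
  shows "velocity A {a..b} \<gamma> t = v"
  unfolding velocity_def
proof (rule the_equality)
  show "has_velocity A {a..b} \<gamma> t v" by (rule v)
  fix w assume w: "has_velocity A {a..b} \<gamma> t w"
  show "w = v"
  proof
    fix c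
    show "w c = v c"
    proof (cases "c \<in> A \<and> \<gamma> t \<in> fst c")
      case True
      then have "((snd c \<circ> \<gamma>) has_vector_derivative w c) (at t within cbox a b)"
        "((snd c \<circ> \<gamma>) has_vector_derivative v c) (at t within cbox a b)"
        using v w by (auto simp: has_velocity_def)
      then show ?thesis using vector_derivative_unique_within_closed_interval[of a b t] ab by auto
    next
      case False
      have "v \<in> tangent_space A (\<gamma> t)" "w \<in> tangent_space A (\<gamma> t)"
        using v w by (simp_all add: has_velocity_def)
      with False show ?thesis by (cases c) (simp add: tangent_space_def)
    qed
  qed
qed

lemma riemannian_metric_nonneg:
  assumes g: "riemannian_metric A g" and v: "v \<in> tangent_space A p"
  shows "0 \<le> g p v v"
proof (cases "v = (\<lambda>c. 0)")
  \<comment> \<open>\<open>riemannian_metric\<close> asks for positivity on nonzero vectors only; on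
    the zero vector linearity gives the value 0.\<close>
  case True
  have "g p (tv_lincomb 0 v 0 v) v = 0 * g p v v + 0 * g p v v"
    using g v unfolding riemannian_metric_def by blast
  moreover have "tv_lincomb 0 v 0 v = v" using True by (simp add: tv_lincomb_def)
  ultimately show ?thesis by simp
next
  case False
  then show ?thesis using g v unfolding riemannian_metric_def by (meson less_imp_le)
qed

text \<open>At break points \<open>velocity\<close> may be an arbitrary value of the description
  operator. Elsewhere a small interval around \<open>t\<close> avoids the finite set
  \<open>F\<close>, and two-sided derivatives there are derivatives within
  \<open>{a..b}\<close>.\<close>

lemma piecewise_C1_curve_velocity:
  assumes F: "finite F"
    "\<And>s u. a \<le> s \<and> s < u \<and> u \<le> b \<and> F \<inter> {s<..<u} = {} \<Longrightarrow> C1_curve A s u \<gamma>"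
    and t: "t \<in> {a..b}" "t \<notin> F \<union> {a, b}"
  shows "velocity A {a..b} \<gamma> t \<in> tangent_space A (\<gamma> t)"
proof -
  have "open ({a<..<b} - F)" using F(1) by (simp add: open_Diff finite_imp_closed)
  moreover have "t \<in> {a<..<b} - F" using t by auto
  ultimately obtain e where e: "e > 0" "cball t e \<subseteq> {a<..<b} - F"
    unfolding open_contains_cball by blast
  then have sub: "{t - e..t + e} \<subseteq> {a<..<b} - F" by (simp add: cball_eq_atLeastAtMost)
  then have "t - e \<in> {a<..<b}" "t + e \<in> {a<..<b}" "F \<inter> {t - e<..<t + e} = {}"
    using e(1) by (auto simp: subset_iff)
  then have "C1_curve A (t - e) (t + e) \<gamma>" using e(1) by (intro F(2)) auto
  then obtain w where "has_velocity A {t - e..t + e} \<gamma> t w"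
    using e(1) unfolding C1_curve_def by force
  moreover have "at t within {t - e..t + e} = at t" "at t within {a..b} = at t"
    using e(1) t by (auto intro!: at_within_Icc_at)
  ultimately have w: "has_velocity A {a..b} \<gamma> t w" by (simp add: has_velocity_def)
  moreover have "velocity A {a..b} \<gamma> t = w" using w t by (intro velocity_eq) auto
  ultimately show ?thesis by (simp add: has_velocity_def)
qed

text \<open>This bounds the set of lengths from below, without which the infimum in
  \<open>induced_dist\<close> says nothing. It is not immediate: at a break point the metric may be
  applied to a meaningless vector, and \<open>sqrt\<close> of a negative real is negative. The
  integrand is therefore set to 0 at finitely many points.\<close>

lemma curve_length_nonneg:
  assumes g: "riemannian_metric A g" and \<gamma>: "piecewise_C1_curve A a b \<gamma>"
  shows "0 \<le> curve_length A g a b \<gamma>"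
proof -
  obtain F where F: "finite F"
    "\<And>s u. a \<le> s \<and> s < u \<and> u \<le> b \<and> F \<inter> {s<..<u} = {} \<Longrightarrow> C1_curve A s u \<gamma>"
    using \<gamma> unfolding piecewise_C1_curve_def by blast
  let ?f = "\<lambda>t. tnorm g (\<gamma> t) (velocity A {a..b} \<gamma> t)"
  let ?h = "\<lambda>t. if t \<in> F \<union> {a, b} then 0 else ?f t"
  have "curve_length A g a b \<gamma> = integral {a..b} ?h"
    unfolding curve_length_def
    by (rule integral_spike[of "F \<union> {a, b}"]) (use F(1) in \<open>auto intro: negligible_finite\<close>)
  also have "\<dots> \<ge> 0"
  proof (cases "?h integrable_on {a..b}")
    case True
    then show ?thesis
    proof (rule integral_nonneg)
      fix t assume "t \<in> {a..b}"
      then show "0 \<le> ?h t"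
        using riemannian_metric_nonneg[where A=A and p="\<gamma> t", OF g piecewise_C1_curve_velocity[where a=a and b=b and F=F, OF F]]
        by (simp add: tnorm_def)
    qed
  next
    case False
    then show ?thesis by (simp add: not_integrable_integral)
  qed
  finally show ?thesis .
qed

lemma induced_dist_le:
  assumes g: "riemannian_metric A g" and ab: "a \<le> b" and \<gamma>: "piecewise_C1_curve A a b \<gamma>" "\<gamma> ` {a..b} \<subseteq> S"
  shows "induced_dist A g S (\<gamma> a) (\<gamma> b) \<le> curve_length A g a b \<gamma>"
  unfolding induced_dist_def
proof (rule cInf_lower)
  show "bdd_below {curve_length A g c d \<gamma>' |c d \<gamma>'. c \<le> d \<and> piecewise_C1_curve A c d \<gamma>' \<and>
      \<gamma>' ` {c..d} \<subseteq> S \<and> \<gamma>' c = \<gamma> a \<and> \<gamma>' d = \<gamma> b}"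
    using curve_length_nonneg[OF g] by (intro bdd_belowI[of _ 0]) auto
qed (use ab \<gamma> in blast)

section \<open>Exponential curves as Lipschitz curves of constant speed\<close>

lemma geodesicD:
  assumes "geodesic A g I \<gamma>" "t \<in> I"
  shows "has_velocity A I \<gamma> t (velocity A I \<gamma> t)"
    "c \<in> A \<Longrightarrow> \<gamma> t \<in> fst c \<Longrightarrow> continuous (at t within I) (\<lambda>s. velocity A I \<gamma> s c)"
proof -
  have t: "has_velocity A I \<gamma> t (velocity A I \<gamma> t) \<and>
     (\<forall>c\<in>A. \<gamma> t \<in> fst c \<longrightarrow> ((\<lambda>s. velocity A I \<gamma> s c) has_vector_derivative
        - christoffel A g c (snd c (\<gamma> t)) (velocity A I \<gamma> t c) (velocity A I \<gamma> t c)) (at t within I))"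
    using assms(1)[unfolded geodesic_def, THEN bspec, OF assms(2)] .
  show "has_velocity A I \<gamma> t (velocity A I \<gamma> t)" using t by (rule conjunct1)
  show "continuous (at t within I) (\<lambda>s. velocity A I \<gamma> s c)" if "c \<in> A" "\<gamma> t \<in> fst c"
    using t[THEN conjunct2, THEN bspec, OF that(1), THEN mp, OF that(2)]
    by (rule has_vector_derivative_continuous)
qed

text \<open>\<open>curve_length\<close> over \<open>{s..t}\<close> uses velocities relative to that
  interval, whereas the constant speed is known for velocities relative to
  \<open>{0..1}\<close>.\<close>

lemma geodesic_restrict:
  assumes \<gamma>: "geodesic A g {0..1} \<gamma>" and st: "0 \<le> s" "s < t" "t \<le> 1"
  shows "C1_curve A s t \<gamma>" "r \<in> {s..t} \<Longrightarrow> velocity A {s..t} \<gamma> r = velocity A {0..1} \<gamma> r"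
proof -
  have hv: "has_velocity A {s..t} \<gamma> r (velocity A {0..1} \<gamma> r)" if "r \<in> {s..t}" for r
    using st that by (intro has_velocity_subset[OF geodesicD(1)[OF \<gamma>]]) auto
  show eq: "velocity A {s..t} \<gamma> r = velocity A {0..1} \<gamma> r" if "r \<in> {s..t}" for r
    using velocity_eq[OF hv[OF that]] st that by simp
  show "C1_curve A s t \<gamma>"
    unfolding C1_curve_def
  proof (intro conjI ballI)
    show "has_velocity A {s..t} \<gamma> r (velocity A {s..t} \<gamma> r)" if "r \<in> {s..t}" for r
      using hv[OF that] eq[OF that] by simp
    fix c assume c: "c \<in> A"
    have "continuous_on {r \<in> {s..t}. \<gamma> r \<in> fst c} (\<lambda>r. velocity A {0..1} \<gamma> r c)"
      unfolding continuous_on_eq_continuous_within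
    proof
      fix r assume r: "r \<in> {r \<in> {s..t}. \<gamma> r \<in> fst c}"
      then have "continuous (at r within {0..1}) (\<lambda>r. velocity A {0..1} \<gamma> r c)"
        using c st by (intro geodesicD(2)[OF \<gamma>]) auto
      then show "continuous (at r within {r \<in> {s..t}. \<gamma> r \<in> fst c}) (\<lambda>r. velocity A {0..1} \<gamma> r c)"
        by (rule continuous_within_subset) (use st in auto)
    qed
    then show "continuous_on {r \<in> {s..t}. \<gamma> r \<in> fst c} (\<lambda>r. velocity A {s..t} \<gamma> r c)"
      by (rule continuous_on_eq) (simp add: eq)
  qed
qed

lemma geodesic_continuous:
  assumes "geodesic A g {0..1} \<gamma>"
  shows "continuous_on {0..1} \<gamma>"
  using geodesicD(1)[OF assms] by (simp add: has_velocity_def continuous_on_def)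

lemma exp_domainD:
  assumes "exp_domain A g S D" "(\<theta>, \<eta>) \<in> D"
  shows "\<theta> \<in> S" "\<eta> \<in> tangent_space A \<theta>"
    "geodesic A g {0..1} (exp_curve A g \<theta> \<eta>)" "exp_curve A g \<theta> \<eta> 0 = \<theta>"
    "velocity A {0..1} (exp_curve A g \<theta> \<eta>) 0 = \<eta>"
    "\<And>t. t \<in> {0..1} \<Longrightarrow> exp_curve A g \<theta> \<eta> t \<in> S"
    "\<And>t. t \<in> {0..1} \<Longrightarrow> tnorm g (exp_curve A g \<theta> \<eta> t) (velocity A {0..1} (exp_curve A g \<theta> \<eta>) t) = tnorm g \<theta> \<eta>"
    "tnorm g \<theta> \<eta> = induced_dist A g S \<theta> (exp_curve A g \<theta> \<eta> 1)"
proof -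
  note D = assms(1)[unfolded exp_domain_def Let_def]
  show "\<theta> \<in> S" "\<eta> \<in> tangent_space A \<theta>"
    using D[THEN conjunct1, THEN bspec, OF assms(2)] by (simp_all only: prod.case)
  have c: "geodesic_from A g \<theta> \<eta> (exp_curve A g \<theta> \<eta>)" "exp_curve A g \<theta> \<eta> ` {0..1} \<subseteq> S"
    "\<forall>t\<in>{0..1}. tnorm g (exp_curve A g \<theta> \<eta> t) (velocity A {0..1} (exp_curve A g \<theta> \<eta>) t) = tnorm g \<theta> \<eta>"
    "tnorm g \<theta> \<eta> = induced_dist A g S \<theta> (exp_map A g \<theta> \<eta>)"
    using D[THEN conjunct2, THEN conjunct2, THEN conjunct1, THEN bspec, OF assms(2)]
    by (auto simp only: prod.case)
  show "geodesic A g {0..1} (exp_curve A g \<theta> \<eta>)" "exp_curve A g \<theta> \<eta> 0 = \<theta>"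
    "velocity A {0..1} (exp_curve A g \<theta> \<eta>) 0 = \<eta>"
    using c(1) by (simp_all only: geodesic_from_def)
  show "exp_curve A g \<theta> \<eta> t \<in> S" if "t \<in> {0..1}" for t using c(2) that by blast
  show "tnorm g (exp_curve A g \<theta> \<eta> t) (velocity A {0..1} (exp_curve A g \<theta> \<eta>) t) = tnorm g \<theta> \<eta>"
    if "t \<in> {0..1}" for t
    using c(3) that by blast
  have "exp_curve A g \<theta> \<eta> 1 = exp_map A g \<theta> \<eta>" by (simp add: exp_curve_def tv_scale_def)
  then show "tnorm g \<theta> \<eta> = induced_dist A g S \<theta> (exp_curve A g \<theta> \<eta> 1)" using c(4) by simp
qed

lemma induced_dist_exp_curve:
  assumes g: "riemannian_metric A g" and D: "exp_domain A g S D" "(\<theta>, \<eta>) \<in> D"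
    and st: "0 \<le> s" "s \<le> t" "t \<le> 1"
  shows "induced_dist A g S (exp_curve A g \<theta> \<eta> s) (exp_curve A g \<theta> \<eta> t) \<le> tnorm g \<theta> \<eta> * (t - s)"
proof -
  note d = exp_domainD[OF D]
  let ?\<gamma> = "exp_curve A g \<theta> \<eta>"
  have "continuous_on {s..t} ?\<gamma>"
    using geodesic_continuous[OF d(3)] by (rule continuous_on_subset) (use st in auto)
  moreover have "C1_curve A s' t' ?\<gamma>" if "s \<le> s' \<and> s' < t' \<and> t' \<le> t" for s' t'
    using that st by (intro geodesic_restrict[OF d(3)]) auto
  ultimately have "piecewise_C1_curve A s t ?\<gamma>"
    unfolding piecewise_C1_curve_def by (blast intro: exI[of _ "{}"])
  moreover have "?\<gamma> ` {s..t} \<subseteq> S" using d(6) st by auto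
  ultimately have "induced_dist A g S (?\<gamma> s) (?\<gamma> t) \<le> curve_length A g s t ?\<gamma>"
    using st by (intro induced_dist_le[OF g])
  also have "\<dots> = tnorm g \<theta> \<eta> * (t - s)"
  proof (cases "s = t")
    case True
    then show ?thesis by (simp add: curve_length_def)
  next
    case False
    have "curve_length A g s t ?\<gamma> = integral {s..t} (\<lambda>_. tnorm g \<theta> \<eta>)"
      unfolding curve_length_def
    proof (rule Henstock_Kurzweil_Integration.integral_cong)
      fix r assume r: "r \<in> {s..t}"
      have "velocity A {s..t} ?\<gamma> r = velocity A {0..1} ?\<gamma> r"
        using st False r by (intro geodesic_restrict(2)[OF d(3)]) auto
      then show "tnorm g (?\<gamma> r) (velocity A {s..t} ?\<gamma> r) = tnorm g \<theta> \<eta>"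
        using d(7)[of r] r st by simp
    qed
    then show ?thesis using st by simp
  qed
  finally show ?thesis .
qed

lemma tnorm_nonneg:
  assumes "riemannian_metric A g" "\<eta> \<in> tangent_space A \<theta>"
  shows "0 \<le> tnorm g \<theta> \<eta>"
  using riemannian_metric_nonneg[OF assms] by (simp add: tnorm_def)

text \<open>The distance from a later to an earlier point is estimated through \<open>E\<close>, because the
  Wasserstein distance is symmetric; this avoids reversing curves.\<close>

lemma lipschitz_exp_curve:
  assumes g: "riemannian_metric A g" and D: "exp_domain A g S D" "(\<theta>, \<eta>) \<in> D"
    and E: "measure_embedding A g S \<Omega> E"
  shows "lipschitz_curve A g S (exp_curve A g \<theta> \<eta>)"
proof -
  note d = exp_domainD[OF D]
  let ?\<gamma> = "exp_curve A g \<theta> \<eta>" and ?n = "tnorm g \<theta> \<eta>"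
  obtain L where L: "L > 0"
    "\<And>\<theta> \<theta>'. \<theta> \<in> S \<Longrightarrow> \<theta>' \<in> S \<Longrightarrow> induced_dist A g S \<theta> \<theta>' / L \<le> wasserstein (E \<theta>) (E \<theta>')"
    "\<And>\<theta> \<theta>'. \<theta> \<in> S \<Longrightarrow> \<theta>' \<in> S \<Longrightarrow> wasserstein (E \<theta>) (E \<theta>') \<le> L * induced_dist A g S \<theta> \<theta>'"
    using E unfolding measure_embedding_def by blast
  have n: "0 \<le> ?n" using tnorm_nonneg[OF g d(2)] .
  \<comment> \<open>The summand 1 serves pairs in forward order; \<open>L * L\<close> is the cost of
    passing to the Wasserstein distance and back for the others.\<close>
  have "induced_dist A g S (?\<gamma> s) (?\<gamma> t) \<le> (1 + L * L) * ?n * \<bar>s - t\<bar>"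
    if st: "s \<in> {0..1}" "t \<in> {0..1}" for s t
  proof (cases "s \<le> t")
    case True
    then have "induced_dist A g S (?\<gamma> s) (?\<gamma> t) \<le> 1 * (?n * \<bar>s - t\<bar>)"
      using induced_dist_exp_curve[OF g D, of s t] st by simp
    also have "\<dots> \<le> (1 + L * L) * (?n * \<bar>s - t\<bar>)" using n L(1) by (intro mult_right_mono) auto
    finally show ?thesis by (simp add: mult.assoc)
  next
    case False
    have "induced_dist A g S (?\<gamma> s) (?\<gamma> t) \<le> L * wasserstein (E (?\<gamma> t)) (E (?\<gamma> s))"
      using L(2)[OF d(6)[OF st(1)] d(6)[OF st(2)]] L(1)
      by (simp add: field_simps wasserstein_commute[of "E (?\<gamma> t)"])
    also have "\<dots> \<le> L * (L * induced_dist A g S (?\<gamma> t) (?\<gamma> s))"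
      using L(1) L(3)[OF d(6)[OF st(2)] d(6)[OF st(1)]] by (intro mult_left_mono) auto
    also have "\<dots> \<le> L * (L * (?n * \<bar>s - t\<bar>))"
      using L(1) False st induced_dist_exp_curve[OF g D, of t s] by (intro mult_left_mono) auto
    also have "\<dots> \<le> (1 + L * L) * (?n * \<bar>s - t\<bar>)" using n by (simp add: algebra_simps)
    finally show ?thesis by (simp add: mult.assoc)
  qed
  then show ?thesis using d(6) unfolding lipschitz_curve_def by blast
qed

lemma tnorm_exp_domain_bounded:
  assumes D: "exp_domain A g S D" and E: "measure_embedding A g S \<Omega> E" and \<Omega>: "compact \<Omega>"
  obtains R where "\<And>\<theta> \<eta>. (\<theta>, \<eta>) \<in> D \<Longrightarrow> tnorm g \<theta> \<eta> \<le> R"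
proof -
  obtain L where L: "L > 0"
    "\<And>\<theta> \<theta>'. \<theta> \<in> S \<Longrightarrow> \<theta>' \<in> S \<Longrightarrow> induced_dist A g S \<theta> \<theta>' / L \<le> wasserstein (E \<theta>) (E \<theta>')"
    using E unfolding measure_embedding_def by blast
  have P: "E \<theta> \<in> prob_measures_on \<Omega>" if "\<theta> \<in> S" for \<theta>
    using E that unfolding measure_embedding_def by blast
  have "tnorm g \<theta> \<eta> \<le> L * diameter \<Omega>" if "(\<theta>, \<eta>) \<in> D" for \<theta> \<eta>
  proof -
    note d = exp_domainD[OF D that]
    have "tnorm g \<theta> \<eta> / L \<le> wasserstein (E \<theta>) (E (exp_curve A g \<theta> \<eta> 1))"
      unfolding d(8) using d by (intro L) auto
    also have "\<dots> \<le> diameter \<Omega>" using d by (intro wasserstein_le_diameter \<Omega> P) auto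
    finally show ?thesis using L(1) by (simp add: field_simps)
  qed
  then show ?thesis using that by blast
qed

section \<open>Flows of the velocity fields\<close>

lemma has_vector_derivative_bound:
  fixes f :: "real \<Rightarrow> 'a::real_normed_vector"
  assumes S: "convex S" and f: "\<And>x. x \<in> S \<Longrightarrow> (f has_vector_derivative f' x) (at x within S)"
    and B: "\<And>x. x \<in> S \<Longrightarrow> norm (f' x) \<le> B" and xy: "x \<in> S" "y \<in> S"
  shows "norm (f x - f y) \<le> B * \<bar>x - y\<bar>"
proof -
  have "norm (f x - f y) \<le> B * norm (x - y)"
  proof (rule differentiable_bound[OF S _ _ xy, where f'="\<lambda>x h. h *\<^sub>R f' x"])
    show "(f has_derivative (\<lambda>h. h *\<^sub>R f' x)) (at x within S)" if "x \<in> S" for x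
      using f[OF that] by (simp add: has_vector_derivative_def)
    show "onorm (\<lambda>h. h *\<^sub>R f' x) \<le> B" if "x \<in> S" for x
      using B[OF that] by (intro onorm_le) (simp add: mult.commute[of B] mult_left_mono)
  qed
  then show ?thesis by simp
qed

text \<open>Freezing the time costs \<open>L\<close> times the time difference, uniformly in space,
  so continuity in space at a single time suffices.\<close>

lemma continuous_on_time_lipschitz:
  fixes v :: "real \<Rightarrow> 'a::euclidean_space \<Rightarrow> 'a"
  assumes c: "\<And>t. continuous_on UNIV (v t)" and L: "\<And>s t x. norm (v s x - v t x) \<le> L * \<bar>s - t\<bar>"
  shows "continuous_on UNIV (\<lambda>z. v (fst z) (snd z))"
  unfolding continuous_on_def
proof
  fix z :: "real \<times> 'a"
  have "((\<lambda>w. v (fst z) (snd w)) \<longlongrightarrow> v (fst z) (snd z)) (at z)"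
    using c[of "fst z"] by (intro isCont_tendsto_compose[of _ "v (fst z)"] tendsto_intros)
      (auto simp: continuous_on_eq_continuous_at)
  moreover have "((\<lambda>w. v (fst w) (snd w) - v (fst z) (snd w)) \<longlongrightarrow> 0) (at z)"
  proof (rule Lim_null_comparison[where g="\<lambda>w. L * \<bar>fst w - fst z\<bar>"])
    have "((\<lambda>w. L * \<bar>fst w - fst z\<bar>) \<longlongrightarrow> L * \<bar>fst z - fst z\<bar>) (at z)" by (intro tendsto_intros)
    then show "((\<lambda>w. L * \<bar>fst w - fst z\<bar>) \<longlongrightarrow> 0) (at z)" by simp
  qed (simp add: L)
  ultimately have "((\<lambda>w. (v (fst w) (snd w) - v (fst z) (snd w)) + v (fst z) (snd w))
      \<longlongrightarrow> 0 + v (fst z) (snd z)) (at z)"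
    by (intro tendsto_add)
  then show "((\<lambda>w. v (fst w) (snd w)) \<longlongrightarrow> v (fst z) (snd z)) (at z within UNIV)" by simp
qed

text \<open>The \<open>C\<^sup>1\<close> bound holds for pairs in \<open>D\<close> only, which need not contain the velocities at
  later times. So only the initial field is Lipschitz in space, and the existence of integral
  curves has to come from Peano's theorem.\<close>

lemma integral_curve_exists:
  fixes v :: "real \<Rightarrow> 'a::euclidean_space \<Rightarrow> 'a"
  assumes c: "\<And>t. t \<in> {0..1} \<Longrightarrow> continuous_on UNIV (v t)"
    and L: "\<And>s t x. s \<in> {0..1} \<Longrightarrow> t \<in> {0..1} \<Longrightarrow> norm (v s x - v t x) \<le> L * \<bar>s - t\<bar>" "0 \<le> L"
    and M: "\<And>x. norm (v 0 x) \<le> M" "\<And>x y. norm (v 0 x - v 0 y) \<le> M * norm (x - y)"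
  obtains y where "y 0 = x"
    "\<And>t. t \<in> {0..1} \<Longrightarrow> (y has_vector_derivative v t (y t)) (at t within {0..1})"
    "\<And>s t. s \<in> {0..1} \<Longrightarrow> t \<in> {0..1} \<Longrightarrow> norm (y s - y t) \<le> (M + L) * \<bar>s - t\<bar>"
    "\<And>t. t \<in> {0..1} \<Longrightarrow> norm (y t - x - t *\<^sub>R v 0 x) \<le> (L + M * (M + L)) * t\<^sup>2"
proof -
  \<comment> \<open>Clamping time to \<open>{0..1}\<close> extends the field to all times as the
    existence theorem requires, without increasing its Lipschitz constant in time.\<close>
  define k where "k t = max 0 (min 1 t)" for t :: real
  have k: "k t \<in> {0..1}" "\<bar>k s - k t\<bar> \<le> \<bar>s - t\<bar>" "t \<in> {0..1} \<Longrightarrow> k t = t" for s t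
    by (auto simp: k_def)
  have M0: "0 \<le> M" using M(1) norm_ge_zero order_trans by blast
  have vM: "norm (v t x) \<le> M + L" if "t \<in> {0..1}" for t x
  proof -
    have "norm (v t x) \<le> norm (v 0 x) + norm (v t x - v 0 x)" by (rule norm_triangle_sub)
    also have "\<dots> \<le> M + L * \<bar>t - 0\<bar>" using that by (intro add_mono M L) auto
    also have "\<dots> \<le> M + L * 1" using that L(2) by (intro add_left_mono mult_left_mono) auto
    finally show ?thesis by simp
  qed
  have cont: "continuous_on UNIV (\<lambda>z. v (k (fst z)) (snd z))"
  proof (rule continuous_on_time_lipschitz[of "\<lambda>t. v (k t)" L])
    show "continuous_on UNIV (v (k t))" for t by (rule c[OF k(1)])
    show "norm (v (k s) x - v (k t) x) \<le> L * \<bar>s - t\<bar>" for s t x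
      using L(1)[OF k(1) k(1), of s x t] mult_left_mono[OF k(2)[of s t] L(2)] by linarith
  qed
  obtain y where y0: "y 0 = x"
    and y': "\<And>t. t \<in> {0..1} \<Longrightarrow> (y has_vector_derivative v (k t) (y t)) (at t within {0..1})"
    using peano_existence[of "\<lambda>t. v (k t)" "M + L" x, OF cont vM[OF k(1)]] by blast
  have y: "(y has_vector_derivative v t (y t)) (at t within {0..1})" if "t \<in> {0..1}" for t
    using y'[OF that] k(3)[OF that] by simp
  have lip: "norm (y s - y t) \<le> (M + L) * \<bar>s - t\<bar>" if "s \<in> {0..1}" "t \<in> {0..1}" for s t
    by (rule has_vector_derivative_bound[where S="{0..1}", OF _ y vM that]) auto
  show ?thesis
  proof (rule that[OF y0 y lip])
    fix t :: real assume t: "t \<in> {0..1}"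
    \<comment> \<open>The mean value inequality for the curve minus its initial tangent. Its
      derivative is at most \<open>L * s\<close> from the change of the field in time, plus
      \<open>M * ((M + L) * s)\<close> because the point has moved by at most
      \<open>(M + L) * s\<close> in the initial field.\<close>
    have "norm ((y t - t *\<^sub>R v 0 x) - (y 0 - 0 *\<^sub>R v 0 x)) \<le> ((L + M * (M + L)) * t) * \<bar>t - 0\<bar>"
    proof (rule has_vector_derivative_bound[where S="{0..t}" and f'="\<lambda>s. v s (y s) - v 0 x"])
      show "((\<lambda>s. y s - s *\<^sub>R v 0 x) has_vector_derivative v s (y s) - v 0 x) (at s within {0..t})"
        if "s \<in> {0..t}" for s
      proof -
        have "(y has_vector_derivative v s (y s)) (at s within {0..t})"
          by (rule has_vector_derivative_within_subset[OF y]) (use that t in auto)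
        then show ?thesis by (auto intro!: derivative_eq_intros)
      qed
      show "norm (v s (y s) - v 0 x) \<le> (L + M * (M + L)) * t" if s: "s \<in> {0..t}" for s
      proof -
        have s1: "s \<in> {0..1}" "0 \<in> {0..1::real}" using s t by auto
        have "norm (v s (y s) - v 0 x) \<le> norm (v s (y s) - v 0 (y s)) + norm (v 0 (y s) - v 0 x)"
          using norm_triangle_ineq[of "v s (y s) - v 0 (y s)" "v 0 (y s) - v 0 x"] by simp
        also have "\<dots> \<le> L * \<bar>s - 0\<bar> + M * norm (y s - x)" by (intro add_mono L M s1)
        also have "\<dots> \<le> L * \<bar>s - 0\<bar> + M * ((M + L) * \<bar>s - 0\<bar>)"
          using lip[OF s1] y0 M0 by (intro add_left_mono mult_left_mono) auto
        also have "\<dots> = (L + M * (M + L)) * s" using s by (simp add: algebra_simps)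
        also have "\<dots> \<le> (L + M * (M + L)) * t"
          using s M0 L(2) by (intro mult_left_mono) auto
        finally show ?thesis .
      qed
    qed (use t in auto)
    then show "norm (y t - x - t *\<^sub>R v 0 x) \<le> (L + M * (M + L)) * t\<^sup>2"
      using t y0 by (simp add: power2_eq_square algebra_simps)
  qed
qed

lemma abs_continuous_on_lipschitz:
  fixes f :: "real \<Rightarrow> 'a::real_normed_vector"
  assumes f: "\<And>s t. s \<in> {a..b} \<Longrightarrow> t \<in> {a..b} \<Longrightarrow> norm (f s - f t) \<le> K * \<bar>s - t\<bar>" and K: "0 \<le> K"
  shows "abs_continuous_on a b f"
  unfolding abs_continuous_on_def
proof (intro allI impI)
  fix \<epsilon> :: real assume \<epsilon>: "0 < \<epsilon>"
  have "(\<Sum>(s, t)\<in>J. norm (f t - f s)) < \<epsilon>"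
    if J: "\<forall>(s, t)\<in>J. a \<le> s \<and> s \<le> t \<and> t \<le> b" "(\<Sum>(s, t)\<in>J. t - s) < \<epsilon> / (K + 1)" for J
  proof -
    have nn: "0 \<le> (\<Sum>(s, t)\<in>J. t - s)" using J(1) by (intro sum_nonneg) auto
    have "(\<Sum>(s, t)\<in>J. norm (f t - f s)) \<le> (\<Sum>(s, t)\<in>J. K * (t - s))"
    proof (rule sum_mono)
      fix z assume "z \<in> J"
      then show "(case z of (s, t) \<Rightarrow> norm (f t - f s)) \<le> (case z of (s, t) \<Rightarrow> K * (t - s))"
        using J(1) f[of "snd z" "fst z"] by (cases z) auto
    qed
    also have "\<dots> = K * (\<Sum>(s, t)\<in>J. t - s)" by (simp add: sum_distrib_left case_prod_unfold)
    also have "\<dots> \<le> (K + 1) * (\<Sum>(s, t)\<in>J. t - s)" using nn by (intro mult_right_mono) auto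
    also have "\<dots> < (K + 1) * (\<epsilon> / (K + 1))" using J(2) K by (intro mult_strict_left_mono) auto
    finally show ?thesis using K by simp
  qed
  then show "\<exists>\<delta>>0. \<forall>J. finite J \<and> (\<forall>(s, t)\<in>J. a \<le> s \<and> s \<le> t \<and> t \<le> b) \<and>
      pairwise (\<lambda>(s, t) (s', t'). {s<..<t} \<inter> {s'<..<t'} = {}) J \<and> (\<Sum>(s, t)\<in>J. t - s) < \<delta> \<longrightarrow>
      (\<Sum>(s, t)\<in>J. norm (f t - f s)) < \<epsilon>"
    using \<epsilon> K by (intro exI[of _ "\<epsilon> / (K + 1)"]) auto
qed

text \<open>If \<open>f\<close> were not measurable, some event and its complement would both have a
  non-measurable preimage and hence both get mass \<open>0\<close>.\<close>

lemma measurable_if_prob_space_distr: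
  assumes "prob_space (distr M N f)" and f: "f \<in> space M \<rightarrow> space N"
  shows "f \<in> measurable M N"
proof (rule ccontr)
  assume "f \<notin> measurable M N"
  then obtain X where X: "X \<in> sets N" "f -` X \<inter> space M \<notin> sets M"
    using f by (auto simp: measurable_def)
  interpret prob_space "distr M N f" by fact
  let ?\<mu> = "\<lambda>X. emeasure M (f -` X \<inter> space M)"
  \<comment> \<open>\<open>measure_of\<close> falls back to the zero measure if the given set
    function is not a measure; total mass one excludes this. Preimages outside \<open>sets M\<close>
    then have \<open>emeasure\<close> 0.\<close>
  have conv: "emeasure (distr M N f) Y = (if measure_space (space N) (sets N) ?\<mu> then ?\<mu> Y else 0)"
    if "Y \<in> sets N" for Y
    unfolding distr_def using that by (simp add: emeasure_measure_of_conv sets.sigma_sets_eq)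
  have "emeasure (distr M N f) (space N) = 1" using emeasure_space_1 by simp
  then have ms: "measure_space (space N) (sets N) ?\<mu>"
    using conv[OF sets.top] by (auto split: if_splits)
  have "f -` (space N - X) \<inter> space M = space M - (f -` X \<inter> space M)" using f by auto
  moreover have "f -` X \<inter> space M = space M - (space M - (f -` X \<inter> space M))" by auto
  ultimately have "f -` (space N - X) \<inter> space M \<notin> sets M" using X(2) sets.compl_sets by metis
  then have "emeasure (distr M N f) X = 0" "emeasure (distr M N f) (space N - X) = 0"
    using X ms by (simp_all add: conv emeasure_notin_sets)
  moreover have "emeasure (distr M N f) (space N) = emeasure (distr M N f) X + emeasure (distr M N f) (space N - X)"
    using X(1) sets.sets_into_space[OF X(1)]
    by (subst plus_emeasure) (auto intro!: arg_cong[where f="emeasure (distr M N f)"])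
  ultimately show False using \<open>emeasure (distr M N f) (space N) = 1\<close> by simp
qed

text \<open>Turns a map specified on \<open>\<Omega>\<close> only into a Borel map of the whole
  space. Measurability of \<open>f\<close> is a consequence of \<open>p\<close>, and
  \<open>h\<close> acts on a null set, so the push-forward is unchanged.\<close>

lemma distr_restrict_extend:
  fixes f h :: "'a::euclidean_space \<Rightarrow> 'a"
  assumes \<mu>: "\<mu> \<in> prob_measures_on \<Omega>" and \<Omega>: "closed \<Omega>"
    and p: "prob_space (distr (restrict_space \<mu> \<Omega>) borel f)" and h: "h \<in> borel_measurable borel"
  defines "q \<equiv> \<lambda>x. if x \<in> \<Omega> then f x else h x"
  shows "q \<in> borel_measurable borel" "distr \<mu> borel q = distr (restrict_space \<mu> \<Omega>) borel f"
proof -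
  note m = prob_measures_onD[OF \<mu>]
  have \<Omega>s: "\<Omega> \<in> sets \<mu>" using \<Omega> m(2) by simp
  have f: "f \<in> borel_measurable (restrict_space \<mu> \<Omega>)"
    by (rule measurable_if_prob_space_distr[OF p]) simp
  have hm: "h \<in> borel_measurable \<mu>" using h by (simp add: measurable_cong_sets[OF m(2) refl])
  have q: "q \<in> borel_measurable \<mu>"
    unfolding q_def using f hm \<Omega>s m(3)
    by (subst measurable_If_restrict_space_iff) (auto intro: measurable_restrict_space1)
  then show "q \<in> borel_measurable borel" by (simp add: measurable_cong_sets[OF m(2) refl])
  show "distr \<mu> borel q = distr (restrict_space \<mu> \<Omega>) borel f"
  proof (rule measure_eqI)
    fix X assume "X \<in> sets (distr \<mu> borel q)"
    then have X: "X \<in> sets borel" by simp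
    have sp: "space (restrict_space \<mu> \<Omega>) = \<Omega>" using m(3) by (simp add: space_restrict_space)
    have fX: "f -` X \<inter> \<Omega> \<in> sets (restrict_space \<mu> \<Omega>)" using measurable_sets[OF f X] sp by simp
    then have fX': "f -` X \<inter> \<Omega> \<in> sets \<mu>"
      using \<Omega>s by (auto simp: sets_restrict_space)
    have "emeasure (distr \<mu> borel q) X = emeasure \<mu> (q -` X \<inter> space \<mu>)"
      by (rule emeasure_distr[OF q X])
    also have "\<dots> = emeasure \<mu> (f -` X \<inter> \<Omega>)"
      using m(4) fX' measurable_sets[OF q X] m(3)
      by (intro emeasure_eq_AE) (auto simp: q_def elim!: eventually_mono)
    also have "\<dots> = emeasure (restrict_space \<mu> \<Omega>) (f -` X \<inter> \<Omega>)"
      using \<Omega>s by (intro emeasure_restrict_space[symmetric]) auto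
    also have "\<dots> = emeasure (distr (restrict_space \<mu> \<Omega>) borel f) X"
      using emeasure_distr[OF f X] sp by simp
    finally show "emeasure (distr \<mu> borel q) X = emeasure (distr (restrict_space \<mu> \<Omega>) borel f) X" .
  qed simp
qed

section \<open>From the bounds on the velocity fields to transport maps\<close>

lemma C1_norm_leD:
  assumes "C1_norm f \<le> ereal c"
  shows "norm (f x) \<le> c" "(\<And>x. f differentiable (at x)) \<Longrightarrow> norm (f x - f y) \<le> c * norm (x - y)"
proof -
  have "max (ereal (norm (f x))) (ereal (onorm (frechet_derivative f (at x)))) \<le> ereal c" for x
    using assms unfolding C1_norm_def by (meson SUP_upper UNIV_I order_trans)
  then have c: "norm (f x) \<le> c" "onorm (frechet_derivative f (at x)) \<le> c" for x
    by simp_all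
  show "norm (f x) \<le> c" by (rule c)
  assume d: "\<And>x. f differentiable (at x)"
  show "norm (f x - f y) \<le> c * norm (x - y)"
  proof (rule differentiable_bound[of UNIV f "\<lambda>x. frechet_derivative f (at x)"])
    show "(f has_derivative frechet_derivative f (at x)) (at x)" for x
      using d[of x] by (simp only: frechet_derivative_works)
  qed (simp_all add: c)
qed

lemma velocity_fieldsD:
  assumes B: "velocity_fields A g S D E B" and "\<theta> \<in> S" "\<eta> \<in> tangent_space A \<theta>"
  shows "B \<theta> \<eta> differentiable (at x)" "continuous_on UNIV (B \<theta> \<eta>)"
    "\<exists>\<psi>. \<forall>x. GDERIV \<psi> x :> B \<theta> \<eta> x"
    "\<xi> \<in> tangent_space A \<theta> \<Longrightarrow> B \<theta> (tv_diff \<eta> \<xi>) x = B \<theta> \<eta> x - B \<theta> \<xi> x"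
proof -
  note v = B[unfolded velocity_fields_def]
  have "Ck_on 1 UNIV (B \<theta> \<eta>)" and grad: "gradient_field (B \<theta> \<eta>)"
    using v[THEN conjunct1, THEN bspec, OF assms(2), THEN bspec, OF assms(3)] by auto
  then show d: "B \<theta> \<eta> differentiable (at x)" for x by simp
  then show "continuous_on UNIV (B \<theta> \<eta>)"
    by (simp add: continuous_at_imp_continuous_on differentiable_imp_continuous_within)
  show "\<exists>\<psi>. \<forall>x. GDERIV \<psi> x :> B \<theta> \<eta> x" using grad by (simp add: gradient_field_def)
  assume \<xi>: "\<xi> \<in> tangent_space A \<theta>"
  have "B \<theta> (tv_lincomb 1 \<eta> (- 1) \<xi>) x = 1 *\<^sub>R B \<theta> \<eta> x + (- 1) *\<^sub>R B \<theta> \<xi> x"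
    using v[THEN conjunct2, THEN conjunct1, THEN bspec, OF assms(2), THEN bspec, OF assms(3), THEN bspec, OF \<xi>]
    by blast
  moreover have "tv_lincomb 1 \<eta> (- 1) \<xi> = tv_diff \<eta> \<xi>" by (simp add: tv_lincomb_def tv_diff_def)
  ultimately show "B \<theta> (tv_diff \<eta> \<xi>) x = B \<theta> \<eta> x - B \<theta> \<xi> x" by simp
qed

text \<open>The bound on the time derivative holds at every \<open>x\<close>, so it integrates to a
  Lipschitz bound in time that is uniform in space.\<close>

lemma velocity_fields_bounds:
  assumes B: "velocity_fields A g S D E B" and D: "exp_domain A g S D"
  obtains C where "C > 0"
    "\<And>\<theta> \<eta> x. (\<theta>, \<eta>) \<in> D \<Longrightarrow> norm (B \<theta> \<eta> x) \<le> C * tnorm g \<theta> \<eta>"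
    "\<And>\<theta> \<eta> x y. (\<theta>, \<eta>) \<in> D \<Longrightarrow> norm (B \<theta> \<eta> x - B \<theta> \<eta> y) \<le> C * tnorm g \<theta> \<eta> * norm (x - y)"
    "\<And>\<theta> \<eta> \<gamma> s t x. (\<theta>, \<eta>) \<in> D \<Longrightarrow> \<gamma> = exp_curve A g \<theta> \<eta> \<Longrightarrow> s \<in> {0..1} \<Longrightarrow> t \<in> {0..1} \<Longrightarrow>
       norm (B (\<gamma> s) (velocity A {0..1} \<gamma> s) x - B (\<gamma> t) (velocity A {0..1} \<gamma> t) x)
         \<le> C * (tnorm g \<theta> \<eta>)\<^sup>2 * \<bar>s - t\<bar>"
proof -
  obtain C where C: "C > 0" and all: "\<forall>(\<theta>, \<eta>)\<in>D.
        tnorm g \<theta> \<eta> / C \<le> L2_norm (E \<theta>) (B \<theta> \<eta>) \<and>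
        L2_norm (E \<theta>) (B \<theta> \<eta>) \<le> C * tnorm g \<theta> \<eta> \<and>
        C1_norm (B \<theta> \<eta>) \<le> ereal (C * tnorm g \<theta> \<eta>) \<and>
        (let \<gamma> = exp_curve A g \<theta> \<eta> in
           \<forall>x. \<forall>t\<in>{0..1}. \<exists>\<delta>.
             ((\<lambda>s. B (\<gamma> s) (velocity A {0..1} \<gamma> s) x) has_vector_derivative \<delta>)
               (at t within {0..1}) \<and>
             norm \<delta> \<le> C * (tnorm g \<theta> \<eta>)\<^sup>2)"
    using B unfolding velocity_fields_def by meson
  have c1: "C1_norm (B \<theta> \<eta>) \<le> ereal (C * tnorm g \<theta> \<eta>)" if "(\<theta>, \<eta>) \<in> D" for \<theta> \<eta>
    using all[THEN bspec, OF that] by (simp only: prod.case)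
  have dt: "\<forall>t\<in>{0..1}. \<exists>\<delta>. ((\<lambda>s. B (\<gamma> s) (velocity A {0..1} \<gamma> s) x) has_vector_derivative \<delta>)
      (at t within {0..1}) \<and> norm \<delta> \<le> C * (tnorm g \<theta> \<eta>)\<^sup>2"
    if "(\<theta>, \<eta>) \<in> D" "\<gamma> = exp_curve A g \<theta> \<eta>" for \<theta> \<eta> \<gamma> x
    using all[THEN bspec, OF that(1)] unfolding that(2) Let_def prod.case by blast
  show ?thesis
  proof (rule that[OF C])
    show "norm (B \<theta> \<eta> x) \<le> C * tnorm g \<theta> \<eta>" if "(\<theta>, \<eta>) \<in> D" for \<theta> \<eta> x
      by (rule C1_norm_leD(1)[OF c1[OF that]])
    show "norm (B \<theta> \<eta> x - B \<theta> \<eta> y) \<le> C * tnorm g \<theta> \<eta> * norm (x - y)" if "(\<theta>, \<eta>) \<in> D" for \<theta> \<eta> x y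
      by (rule C1_norm_leD(2)[OF c1[OF that] velocity_fieldsD(1)[OF B exp_domainD(1,2)[OF D that]]])
    fix \<theta> \<eta> \<gamma> s t x assume a: "(\<theta>, \<eta>) \<in> D" "\<gamma> = exp_curve A g \<theta> \<eta>" "s \<in> {0..1::real}" "t \<in> {0..1::real}"
    obtain d where d: "\<And>t. t \<in> {0..1} \<Longrightarrow> ((\<lambda>s. B (\<gamma> s) (velocity A {0..1} \<gamma> s) x) has_vector_derivative d t)
      (at t within {0..1})" "\<And>t. t \<in> {0..1} \<Longrightarrow> norm (d t) \<le> C * (tnorm g \<theta> \<eta>)\<^sup>2"
      using bchoice[OF dt[OF a(1,2), of x]] by blast
    show "norm (B (\<gamma> s) (velocity A {0..1} \<gamma> s) x - B (\<gamma> t) (velocity A {0..1} \<gamma> t) x)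
         \<le> C * (tnorm g \<theta> \<eta>)\<^sup>2 * \<bar>s - t\<bar>"
      by (rule has_vector_derivative_bound[where S="{0..1}", OF _ d a(3,4)]) auto
  qed
qed

text \<open>The map \<open>p\<close> is the time \<open>t\<close> value of the chosen integral
  curves. All estimates are stated at every point of the space rather than almost everywhere, so
  that they yield L2 bounds for any probability measure at once.\<close>

lemma exp_curve_transport_map:
  assumes \<Omega>: "compact \<Omega>" and g: "riemannian_metric A g" and D: "exp_domain A g S D"
    and E: "measure_embedding A g S \<Omega> E" and B: "velocity_fields A g S D E B"
    and tr: "transported_by_flow A g S \<Omega> E B"
  obtains C where "C > 0"
    "\<And>\<theta> \<eta> x y. (\<theta>, \<eta>) \<in> D \<Longrightarrow> norm (B \<theta> \<eta> x - B \<theta> \<eta> y) \<le> C * tnorm g \<theta> \<eta> * norm (x - y)"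
    "\<And>\<theta> \<eta> t. (\<theta>, \<eta>) \<in> D \<Longrightarrow> t \<in> {0..1} \<Longrightarrow> \<exists>p. p \<in> borel_measurable borel \<and>
       distr (E \<theta>) borel p = E (exp_curve A g \<theta> \<eta> t) \<and>
       (\<forall>x. norm (p x - x) \<le> C * tnorm g \<theta> \<eta> * t) \<and>
       (\<forall>x. norm (p x - x - t *\<^sub>R B \<theta> \<eta> x) \<le> C * (tnorm g \<theta> \<eta>)\<^sup>2 * t\<^sup>2)"
proof -
  obtain R' where R': "\<And>\<theta> \<eta>. (\<theta>, \<eta>) \<in> D \<Longrightarrow> tnorm g \<theta> \<eta> \<le> R'"
    using tnorm_exp_domain_bounded[OF D E \<Omega>] by blast
  \<comment> \<open>The maximum keeps \<open>R\<close> nonnegative even if \<open>D\<close> is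
    empty.\<close>
  define R where "R = max R' 0"
  obtain C where C: "C > 0"
    "\<And>\<theta> \<eta> x. (\<theta>, \<eta>) \<in> D \<Longrightarrow> norm (B \<theta> \<eta> x) \<le> C * tnorm g \<theta> \<eta>"
    "\<And>\<theta> \<eta> x y. (\<theta>, \<eta>) \<in> D \<Longrightarrow> norm (B \<theta> \<eta> x - B \<theta> \<eta> y) \<le> C * tnorm g \<theta> \<eta> * norm (x - y)"
    "\<And>\<theta> \<eta> \<gamma> s t x. (\<theta>, \<eta>) \<in> D \<Longrightarrow> \<gamma> = exp_curve A g \<theta> \<eta> \<Longrightarrow> s \<in> {0..1} \<Longrightarrow> t \<in> {0..1} \<Longrightarrow>
       norm (B (\<gamma> s) (velocity A {0..1} \<gamma> s) x - B (\<gamma> t) (velocity A {0..1} \<gamma> t) x)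
         \<le> C * (tnorm g \<theta> \<eta>)\<^sup>2 * \<bar>s - t\<bar>"
    by (rule velocity_fields_bounds[OF B D]) (rule that, assumption+)
  \<comment> \<open>With \<open>n\<close> the norm of the tangent vector, displacement and remainder
    have factors \<open>(C * (1 + n)) * n\<close> and
    \<open>(C + C * (C * (1 + n))) * n\<^sup>2\<close>. Replacing \<open>n\<close> by
    \<open>R\<close> inside the brackets leaves constants that \<open>C'\<close> dominates.\<close>
  define C' where "C' = C * (1 + R) + C * (C * (1 + R))"
  have R0: "0 \<le> R" by (simp add: R_def)
  have "C * 1 \<le> C * (1 + R)" using C(1) R0 by (intro mult_left_mono) auto
  moreover have CR0: "0 \<le> C * (C * (1 + R))" using C(1) R0 by simp
  ultimately have CC': "C \<le> C'" "C * (1 + R) \<le> C'" "C + C * (C * (1 + R)) \<le> C'"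
    by (auto simp: C'_def)
  show ?thesis
  proof (rule that[of C'])
    show C'0: "0 < C'" using C(1) CC'(1) by simp
    show "norm (B \<theta> \<eta> x - B \<theta> \<eta> y) \<le> C' * tnorm g \<theta> \<eta> * norm (x - y)" if \<eta>: "(\<theta>, \<eta>) \<in> D" for \<theta> \<eta> x y
    proof (rule order_trans[OF C(3)[OF \<eta>]])
      show "C * tnorm g \<theta> \<eta> * norm (x - y) \<le> C' * tnorm g \<theta> \<eta> * norm (x - y)"
        using CC'(1) tnorm_nonneg[OF g exp_domainD(2)[OF D \<eta>]] by (intro mult_right_mono) auto
    qed
    fix \<theta> \<eta> t assume \<eta>: "(\<theta>, \<eta>) \<in> D" and t: "t \<in> {0..1::real}"
    note d = exp_domainD[OF D \<eta>]
    define n where "n = tnorm g \<theta> \<eta>"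
    define \<gamma> where "\<gamma> = exp_curve A g \<theta> \<eta>"
    define v where "v t = B (\<gamma> t) (velocity A {0..1} \<gamma> t)" for t
    have n: "0 \<le> n" "n \<le> R" using tnorm_nonneg[OF g d(2)] R'[OF \<eta>] by (auto simp: n_def R_def)
    have v0: "v 0 = B \<theta> \<eta>" using d(4,5) by (simp add: v_def \<gamma>_def)
    have vel: "has_velocity A {0..1} \<gamma> s (velocity A {0..1} \<gamma> s)" if "s \<in> {0..1}" for s
      using geodesicD(1)[OF d(3) that] by (simp add: \<gamma>_def)
    have vc: "continuous_on UNIV (v s)" if "s \<in> {0..1}" for s
      using velocity_fieldsD(2)[OF B d(6)[OF that]] vel[OF that]
      by (simp add: v_def \<gamma>_def has_velocity_def)
    have vL: "norm (v s x - v r x) \<le> C * n\<^sup>2 * \<bar>s - r\<bar>" if "s \<in> {0..1}" "r \<in> {0..1}" for s r x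
      using C(4)[OF \<eta> \<gamma>_def that, of x] by (simp add: v_def n_def)
    have vM: "norm (v 0 x) \<le> C * n" "norm (v 0 x - v 0 y) \<le> C * n * norm (x - y)" for x y
      using C(2)[OF \<eta>] C(3)[OF \<eta>] by (simp_all add: v0 n_def)
    have L0: "0 \<le> C * n\<^sup>2" using C(1) by simp
    have "\<exists>y. y 0 = x \<and> (\<forall>s\<in>{0..1}. (y has_vector_derivative v s (y s)) (at s within {0..1})) \<and>
        (\<forall>s\<in>{0..1}. \<forall>r\<in>{0..1}. norm (y s - y r) \<le> (C * n + C * n\<^sup>2) * \<bar>s - r\<bar>) \<and>
        (\<forall>s\<in>{0..1}. norm (y s - x - s *\<^sub>R v 0 x) \<le> (C * n\<^sup>2 + C * n * (C * n + C * n\<^sup>2)) * s\<^sup>2)" for x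
      using integral_curve_exists[where v=v and x=x, OF vc vL L0 vM] by metis
    \<comment> \<open>One integral curve is picked for each starting point, with no regularity in
      that point.\<close>
    then obtain y where y: "\<And>x. y x 0 = x"
      "\<And>x s. s \<in> {0..1} \<Longrightarrow> (y x has_vector_derivative v s (y x s)) (at s within {0..1})"
      "\<And>x s r. s \<in> {0..1} \<Longrightarrow> r \<in> {0..1} \<Longrightarrow> norm (y x s - y x r) \<le> (C * n + C * n\<^sup>2) * \<bar>s - r\<bar>"
      "\<And>x s. s \<in> {0..1} \<Longrightarrow> norm (y x s - x - s *\<^sub>R v 0 x) \<le> (C * n\<^sup>2 + C * n * (C * n + C * n\<^sup>2)) * s\<^sup>2"
      by metis
    define \<phi> where "\<phi> s x = y x s" for s x
    have "abs_continuous_on 0 1 (\<lambda>s. \<phi> s x)" for x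
      unfolding \<phi>_def by (rule abs_continuous_on_lipschitz[OF y(3)]) (use C(1) n in auto)
    moreover have "\<exists>w. has_velocity A {0..1} \<gamma> s w \<and>
        (\<forall>x\<in>\<Omega>. ((\<lambda>s. \<phi> s x) has_vector_derivative B (\<gamma> s) w (\<phi> s x)) (at s within {0..1}))"
      if "s \<in> {0..1}" for s
      using vel[OF that] y(2)[OF that] by (auto simp: \<phi>_def v_def)
    ultimately have "flow_along A \<Omega> B \<gamma> \<phi>"
      unfolding flow_along_def by (auto simp: \<phi>_def y(1))
    moreover have "lipschitz_curve A g S \<gamma>"
      unfolding \<gamma>_def by (rule lipschitz_exp_curve[OF g D \<eta> E])
    ultimately have dist: "E (\<gamma> t) = distr (restrict_space (E \<theta>) \<Omega>) borel (\<phi> t)"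
      using tr t d(4) unfolding transported_by_flow_def \<gamma>_def by metis
    have P: "E \<theta> \<in> prob_measures_on \<Omega>" "E (\<gamma> t) \<in> prob_measures_on \<Omega>"
      using E d(1) d(6)[OF t] unfolding measure_embedding_def \<gamma>_def by auto
    \<comment> \<open>outside \<open>\<Omega>\<close>, where the flow is unspecified, all estimates hold trivially\<close>
    define p where "p x = (if x \<in> \<Omega> then \<phi> t x else x + t *\<^sub>R B \<theta> \<eta> x)" for x
    have "(\<lambda>x. x + t *\<^sub>R B \<theta> \<eta> x) \<in> borel_measurable borel"
      using velocity_fieldsD(2)[OF B d(1,2)]
      by (intro borel_measurable_continuous_onI continuous_intros)
    note pm = distr_restrict_extend[OF P(1) compact_imp_closed[OF \<Omega>] _ this, of "\<phi> t", folded p_def dist]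
    have pm': "p \<in> borel_measurable borel" "distr (E \<theta>) borel p = E (\<gamma> t)"
      using pm prob_measures_onD(1)[OF P(2)] unfolding p_def by blast+
    have "norm (p x - x) \<le> C' * n * t" for x
    proof (cases "x \<in> \<Omega>")
      case True
      then have "norm (p x - x) \<le> (C * n + C * n\<^sup>2) * \<bar>t - 0\<bar>"
        using y(3)[OF t, of 0 x] by (simp add: p_def \<phi>_def y(1))
      also have "\<dots> = C * (1 + n) * (n * t)" using t by (simp add: power2_eq_square algebra_simps)
      also have "\<dots> \<le> C' * (n * t)"
      proof (intro mult_right_mono)
        have "C * (1 + n) \<le> C * (1 + R)" using C(1) n by (intro mult_left_mono) auto
        then show "C * (1 + n) \<le> C'" using CC'(2) by simp
      qed (use n t in auto)
      finally show ?thesis by (simp add: mult.assoc)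
    next
      case False
      then have "norm (p x - x) = t * norm (v 0 x)" using t by (simp add: p_def v0)
      also have "\<dots> \<le> t * (C * n)" using vM(1) t by (intro mult_left_mono) auto
      also have "\<dots> = C * (n * t)" by simp
      also have "\<dots> \<le> C' * (n * t)" using CC'(1) n t by (intro mult_right_mono) auto
      finally show ?thesis by (simp add: mult.assoc)
    qed
    moreover have "norm (p x - x - t *\<^sub>R B \<theta> \<eta> x) \<le> C' * n\<^sup>2 * t\<^sup>2" for x
    proof (cases "x \<in> \<Omega>")
      case True
      then have "norm (p x - x - t *\<^sub>R B \<theta> \<eta> x) \<le> (C * n\<^sup>2 + C * n * (C * n + C * n\<^sup>2)) * t\<^sup>2"
        using y(4)[OF t, of x] by (simp add: p_def \<phi>_def v0)
      also have "\<dots> = (C + C * (C * (1 + n))) * (n\<^sup>2 * t\<^sup>2)"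
        by (simp add: power2_eq_square algebra_simps)
      also have "\<dots> \<le> C' * (n\<^sup>2 * t\<^sup>2)"
      proof (intro mult_right_mono)
        have "C * (C * (1 + n)) \<le> C * (C * (1 + R))" using C(1) n by (intro mult_left_mono) auto
        then show "C + C * (C * (1 + n)) \<le> C'" using CC'(3) by simp
      qed auto
      finally show ?thesis by (simp add: mult.assoc)
    next
      case False
      then show ?thesis using C'0 by (simp add: p_def)
    qed
    ultimately show "\<exists>p. p \<in> borel_measurable borel \<and> distr (E \<theta>) borel p = E (exp_curve A g \<theta> \<eta> t) \<and>
       (\<forall>x. norm (p x - x) \<le> C' * tnorm g \<theta> \<eta> * t) \<and>
       (\<forall>x. norm (p x - x - t *\<^sub>R B \<theta> \<eta> x) \<le> C' * (tnorm g \<theta> \<eta>)\<^sup>2 * t\<^sup>2)"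
      using pm' unfolding n_def \<gamma>_def by blast
  qed
qed

section \<open>Comparison with the optimal maps\<close>

lemma L2_norm_scaleR: "0 \<le> t \<Longrightarrow> L2_norm M (\<lambda>x. t *\<^sub>R f x) = t * L2_norm M f"
  by (simp add: L2_norm_def power_mult_distrib real_sqrt_mult)

text \<open>The flow maps and the optimal maps are both compared with the same difference
  \<open>F\<^sub>1 - F\<^sub>2\<close>. Most of the work is square integrability, without which
  \<open>L2_norm\<close> obeys no triangle inequality.\<close>

lemma L2_norm_displacements:
  fixes p\<^sub>1 p\<^sub>2 F\<^sub>1 F\<^sub>2 :: "'a::euclidean_space \<Rightarrow> 'a"
  assumes \<rho>: "\<rho> \<in> prob_measures_on \<Omega>" and \<mu>: "distr \<rho> borel p\<^sub>1 \<in> prob_measures_on \<Omega>"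
    "distr \<rho> borel p\<^sub>2 \<in> prob_measures_on \<Omega>"
    and \<Omega>: "compact \<Omega>" and p: "p\<^sub>1 \<in> borel_measurable borel" "p\<^sub>2 \<in> borel_measurable borel"
    and F: "continuous_on UNIV F\<^sub>1" "continuous_on UNIV F\<^sub>2"
    and e: "\<And>x. norm (p\<^sub>1 x - x - F\<^sub>1 x) \<le> e\<^sub>1" "\<And>x. norm (p\<^sub>2 x - x - F\<^sub>2 x) \<le> e\<^sub>2"
    and m: "\<And>x. norm (p\<^sub>1 x - x) \<le> m\<^sub>1" "\<And>x. norm (p\<^sub>2 x - x) \<le> m\<^sub>2"
  shows "L2_norm \<rho> (\<lambda>x. p\<^sub>1 x - p\<^sub>2 x) \<le> m\<^sub>1 + m\<^sub>2"
    "\<bar>L2_norm \<rho> (\<lambda>x. p\<^sub>1 x - p\<^sub>2 x) - L2_norm \<rho> (\<lambda>x. F\<^sub>1 x - F\<^sub>2 x)\<bar> \<le> e\<^sub>1 + e\<^sub>2"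
    "\<And>T\<^sub>1 T\<^sub>2. \<lbrakk>optimal_map \<rho> (distr \<rho> borel p\<^sub>1) T\<^sub>1; optimal_map \<rho> (distr \<rho> borel p\<^sub>2) T\<^sub>2;
       L2_norm \<rho> (\<lambda>x. T\<^sub>1 x - x - F\<^sub>1 x) \<le> d\<^sub>1; L2_norm \<rho> (\<lambda>x. T\<^sub>2 x - x - F\<^sub>2 x) \<le> d\<^sub>2\<rbrakk> \<Longrightarrow>
       \<bar>L2_norm \<rho> (\<lambda>x. T\<^sub>1 x - T\<^sub>2 x) - L2_norm \<rho> (\<lambda>x. F\<^sub>1 x - F\<^sub>2 x)\<bar> \<le> d\<^sub>1 + d\<^sub>2"
proof -
  note l = prob_measures_onD[OF \<rho>]
  have meas: "(\<lambda>x. x) \<in> borel_measurable \<rho>" "p\<^sub>1 \<in> borel_measurable \<rho>" "p\<^sub>2 \<in> borel_measurable \<rho>"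
    "F\<^sub>1 \<in> borel_measurable \<rho>" "F\<^sub>2 \<in> borel_measurable \<rho>"
    using p F by (auto simp: measurable_cong_sets[OF l(2) refl] intro: borel_measurable_continuous_onI)
  have sq: "sq_integrable \<rho> f"
    if "f \<in> borel_measurable \<rho>" "\<And>x. norm (f x) \<le> c" for f :: "'a \<Rightarrow> 'a" and c
    using that by (intro sq_integrable_bounded[OF l(1), of f c]) auto
  have s: "sq_integrable \<rho> (\<lambda>x. p\<^sub>1 x - x - F\<^sub>1 x)" "sq_integrable \<rho> (\<lambda>x. p\<^sub>2 x - x - F\<^sub>2 x)"
    "sq_integrable \<rho> (\<lambda>x. p\<^sub>1 x - x)" "sq_integrable \<rho> (\<lambda>x. p\<^sub>2 x - x)"
    using meas by (auto intro!: sq e m borel_measurable_diff)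
  have pp: "sq_integrable \<rho> (\<lambda>x. p\<^sub>1 x - p\<^sub>2 x)" using sq_integrable_diff[OF s(3,4)] by simp
  \<comment> \<open>No bound on the fields is given, but each is the difference of the two bounded
    functions \<open>p x - x\<close> and \<open>p x - x - F x\<close>.\<close>
  have FF: "sq_integrable \<rho> (\<lambda>x. F\<^sub>1 x - F\<^sub>2 x)"
    using sq_integrable_diff[OF sq_integrable_diff[OF s(3,1)] sq_integrable_diff[OF s(4,2)]] by simp
  have "norm (p\<^sub>1 x - p\<^sub>2 x) \<le> m\<^sub>1 + m\<^sub>2" for x
    using norm_triangle_ineq4[of "p\<^sub>1 x - x" "p\<^sub>2 x - x"] m(1)[of x] m(2)[of x] by simp
  then show "L2_norm \<rho> (\<lambda>x. p\<^sub>1 x - p\<^sub>2 x) \<le> m\<^sub>1 + m\<^sub>2" by (rule L2_norm_bound[OF l(1)])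
  have dev: "\<bar>L2_norm \<rho> (\<lambda>x. q\<^sub>1 x - q\<^sub>2 x) - L2_norm \<rho> (\<lambda>x. F\<^sub>1 x - F\<^sub>2 x)\<bar> \<le> a\<^sub>1 + a\<^sub>2"
    if q: "sq_integrable \<rho> (\<lambda>x. q\<^sub>1 x - x - F\<^sub>1 x)" "sq_integrable \<rho> (\<lambda>x. q\<^sub>2 x - x - F\<^sub>2 x)"
      and a: "L2_norm \<rho> (\<lambda>x. q\<^sub>1 x - x - F\<^sub>1 x) \<le> a\<^sub>1" "L2_norm \<rho> (\<lambda>x. q\<^sub>2 x - x - F\<^sub>2 x) \<le> a\<^sub>2"
    for q\<^sub>1 q\<^sub>2 a\<^sub>1 a\<^sub>2
  proof -
    have eq: "q\<^sub>1 x - q\<^sub>2 x = ((q\<^sub>1 x - x - F\<^sub>1 x) - (q\<^sub>2 x - x - F\<^sub>2 x)) + (F\<^sub>1 x - F\<^sub>2 x)" for x by simp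
    have qq: "sq_integrable \<rho> (\<lambda>x. q\<^sub>1 x - q\<^sub>2 x)"
      unfolding eq by (rule sq_integrable_add[OF sq_integrable_diff[OF q] FF])
    have "\<bar>L2_norm \<rho> (\<lambda>x. q\<^sub>1 x - q\<^sub>2 x) - L2_norm \<rho> (\<lambda>x. F\<^sub>1 x - F\<^sub>2 x)\<bar>
        \<le> L2_norm \<rho> (\<lambda>x. (q\<^sub>1 x - q\<^sub>2 x) - (F\<^sub>1 x - F\<^sub>2 x))"
      by (rule L2_norm_abs_diff_le[OF qq FF])
    also have "(\<lambda>x. (q\<^sub>1 x - q\<^sub>2 x) - (F\<^sub>1 x - F\<^sub>2 x)) = (\<lambda>x. (q\<^sub>1 x - x - F\<^sub>1 x) - (q\<^sub>2 x - x - F\<^sub>2 x))"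
      by (simp add: algebra_simps)
    also have "L2_norm \<rho> \<dots> \<le> a\<^sub>1 + a\<^sub>2" using L2_norm_diff_le[OF q] a by simp
    finally show ?thesis .
  qed
  show "\<bar>L2_norm \<rho> (\<lambda>x. p\<^sub>1 x - p\<^sub>2 x) - L2_norm \<rho> (\<lambda>x. F\<^sub>1 x - F\<^sub>2 x)\<bar> \<le> e\<^sub>1 + e\<^sub>2"
    using s e by (intro dev L2_norm_bound[OF l(1)])
  \<comment> \<open>An optimal map is not bounded pointwise; integrability is read off its coupling,
    which is concentrated on a compact set.\<close>
  have sT: "sq_integrable \<rho> (\<lambda>x. T x - x - F x)"
    if T: "optimal_map \<rho> \<nu> T" and \<nu>: "\<nu> \<in> prob_measures_on \<Omega>" and F: "continuous_on UNIV F"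
    for \<nu> T and F :: "'a \<Rightarrow> 'a"
  proof -
    have Tb: "T \<in> borel_measurable borel" and \<pi>: "distr \<rho> borel (\<lambda>x. (x, T x)) \<in> couplings \<rho> \<nu>"
      using T by (auto simp: optimal_map_def optimal_coupling_def)
    have Tm: "T \<in> borel_measurable \<rho>" "F \<in> borel_measurable \<rho>"
      using Tb F by (auto simp: measurable_cong_sets[OF l(2) refl] intro: borel_measurable_continuous_onI)
    have pm: "(\<lambda>x. (x, T x)) \<in> borel_measurable \<rho>" using meas(1) Tm(1) by measurable
    have "continuous_on UNIV (\<lambda>z. (norm (snd z - fst z - F (fst z)))\<^sup>2)"
      by (intro continuous_intros continuous_on_compose2[OF F _ subset_UNIV])
    from couplings_integrable[OF \<pi> \<rho> \<nu> \<Omega> this]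
    have "integrable \<rho> (\<lambda>x. (norm (T x - x - F x))\<^sup>2)"
      by (subst (asm) integrable_distr_eq[OF pm])
        (auto intro!: borel_measurable_sq_deviation F)
    moreover have "(\<lambda>x. T x - x - F x) \<in> borel_measurable \<rho>" using meas(1) Tm by measurable
    ultimately show ?thesis by (simp add: sq_integrable_def)
  qed
  show "\<bar>L2_norm \<rho> (\<lambda>x. T\<^sub>1 x - T\<^sub>2 x) - L2_norm \<rho> (\<lambda>x. F\<^sub>1 x - F\<^sub>2 x)\<bar> \<le> d\<^sub>1 + d\<^sub>2"
    if "optimal_map \<rho> (distr \<rho> borel p\<^sub>1) T\<^sub>1" "optimal_map \<rho> (distr \<rho> borel p\<^sub>2) T\<^sub>2"
       "L2_norm \<rho> (\<lambda>x. T\<^sub>1 x - x - F\<^sub>1 x) \<le> d\<^sub>1" "L2_norm \<rho> (\<lambda>x. T\<^sub>2 x - x - F\<^sub>2 x) \<le> d\<^sub>2" for T\<^sub>1 T\<^sub>2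
    using that by (intro dev sT[OF _ \<mu>(1) F(1)] sT[OF _ \<mu>(2) F(2)])
qed

text \<open>In the first bound, with \<open>N = n\<^sub>1 + n\<^sub>2\<close>, one \<open>C\<close>
  comes from replacing the flow maps by \<open>t\<close> times the fields. A further
  \<open>C + C\<^sup>2\<close> is the error of following the gradient, and
  \<open>4 * C\<^sup>2\<close> is the loss from its Lipschitz constant
  \<open>C * N * t\<close>.\<close>

lemma wasserstein_displacements:
  fixes p\<^sub>1 p\<^sub>2 F\<^sub>1 F\<^sub>2 :: "'a::euclidean_space \<Rightarrow> 'a"
  assumes \<rho>: "\<rho> \<in> prob_measures_on \<Omega>" and \<mu>: "distr \<rho> borel p\<^sub>1 \<in> prob_measures_on \<Omega>"
    "distr \<rho> borel p\<^sub>2 \<in> prob_measures_on \<Omega>"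
    and \<Omega>: "compact \<Omega>" and p: "p\<^sub>1 \<in> borel_measurable borel" "p\<^sub>2 \<in> borel_measurable borel"
    and grad: "\<exists>\<psi>. \<forall>x. GDERIV \<psi> x :> F\<^sub>1 x" "\<exists>\<psi>. \<forall>x. GDERIV \<psi> x :> F\<^sub>2 x"
    and lip: "\<And>x y. norm (F\<^sub>1 x - F\<^sub>1 y) \<le> C * n\<^sub>1 * norm (x - y)"
      "\<And>x y. norm (F\<^sub>2 x - F\<^sub>2 y) \<le> C * n\<^sub>2 * norm (x - y)"
    and m: "\<And>x. norm (p\<^sub>1 x - x) \<le> C * n\<^sub>1 * t" "\<And>x. norm (p\<^sub>2 x - x) \<le> C * n\<^sub>2 * t"
    and e: "\<And>x. norm (p\<^sub>1 x - x - t *\<^sub>R F\<^sub>1 x) \<le> C * n\<^sub>1\<^sup>2 * t\<^sup>2"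
      "\<And>x. norm (p\<^sub>2 x - x - t *\<^sub>R F\<^sub>2 x) \<le> C * n\<^sub>2\<^sup>2 * t\<^sup>2"
    and pos: "0 < C" "0 \<le> n\<^sub>1" "0 \<le> n\<^sub>2" "0 \<le> t"
  defines "W \<equiv> wasserstein (distr \<rho> borel p\<^sub>1) (distr \<rho> borel p\<^sub>2)"
    and "\<beta> \<equiv> L2_norm \<rho> (\<lambda>x. F\<^sub>1 x - F\<^sub>2 x)"
  shows "\<bar>W - t * \<beta>\<bar> \<le> (2 * C + 5 * C\<^sup>2) * (n\<^sub>1 + n\<^sub>2)\<^sup>2 * t\<^sup>2"
    "\<And>T\<^sub>1 T\<^sub>2 R. \<lbrakk>optimal_map \<rho> (distr \<rho> borel p\<^sub>1) T\<^sub>1; optimal_map \<rho> (distr \<rho> borel p\<^sub>2) T\<^sub>2;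
       n\<^sub>1 \<le> R; n\<^sub>2 \<le> R\<rbrakk> \<Longrightarrow> \<bar>L2_norm \<rho> (\<lambda>x. T\<^sub>1 x - T\<^sub>2 x) - t * \<beta>\<bar>
         \<le> C * (n\<^sub>1 + n\<^sub>2)\<^sup>2 * t\<^sup>2 + 2 * C * sqrt (C * R) * (n\<^sub>1 + n\<^sub>2) * t powr (3 / 2)"
proof -
  note l = prob_measures_onD[OF \<rho>]
  define N where "N = n\<^sub>1 + n\<^sub>2"
  define G\<^sub>1 G\<^sub>2 where "G\<^sub>1 x = t *\<^sub>R F\<^sub>1 x" and "G\<^sub>2 x = t *\<^sub>R F\<^sub>2 x" for x
  obtain \<psi>\<^sub>1 \<psi>\<^sub>2 where \<psi>: "\<And>x. GDERIV \<psi>\<^sub>1 x :> F\<^sub>1 x" "\<And>x. GDERIV \<psi>\<^sub>2 x :> F\<^sub>2 x" using grad by blast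
  have scal: "GDERIV (\<lambda>x. t * \<psi> x) x :> t *\<^sub>R F" if "GDERIV \<psi> x :> F" for \<psi> F and x :: 'a
    using that unfolding gderiv_def by (auto intro!: derivative_eq_intros simp: inner_commute)
  have G: "GDERIV (\<lambda>x. t * \<psi>\<^sub>1 x) x :> G\<^sub>1 x" "GDERIV (\<lambda>x. t * \<psi>\<^sub>2 x) x :> G\<^sub>2 x" for x
    unfolding G\<^sub>1_def G\<^sub>2_def by (intro scal \<psi>)+
  have Glip: "norm (G\<^sub>1 x - G\<^sub>1 y) \<le> (C * n\<^sub>1 * t) * norm (x - y)"
    "norm (G\<^sub>2 x - G\<^sub>2 y) \<le> (C * n\<^sub>2 * t) * norm (x - y)" for x y
    using mult_left_mono[OF lip(1)[of x y] pos(4)] mult_left_mono[OF lip(2)[of x y] pos(4)] pos(4)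
    by (simp_all add: G\<^sub>1_def G\<^sub>2_def scaleR_diff_right[symmetric] mult_ac)
  have K0: "0 \<le> C * n\<^sub>1 * t" "0 \<le> C * n\<^sub>2 * t" using pos by auto
  have "(C * n\<^sub>1 * t)-lipschitz_on UNIV G\<^sub>1" "(C * n\<^sub>2 * t)-lipschitz_on UNIV G\<^sub>2"
    using Glip K0 by (auto intro!: lipschitz_onI simp: dist_norm)
  then have Gc: "continuous_on UNIV G\<^sub>1" "continuous_on UNIV G\<^sub>2"
    by (auto intro: lipschitz_on_continuous_on)
  note disp = L2_norm_displacements[OF \<rho> \<mu> \<Omega> p Gc e[folded G\<^sub>1_def G\<^sub>2_def] m]
  define \<Phi> where "\<Phi> = L2_norm \<rho> (\<lambda>x. p\<^sub>1 x - p\<^sub>2 x)"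
  have "(\<lambda>x. G\<^sub>1 x - G\<^sub>2 x) = (\<lambda>x. t *\<^sub>R (F\<^sub>1 x - F\<^sub>2 x))"
    by (simp add: G\<^sub>1_def G\<^sub>2_def scaleR_diff_right)
  then have \<beta>: "L2_norm \<rho> (\<lambda>x. G\<^sub>1 x - G\<^sub>2 x) = t * \<beta>"
    using pos(4) by (simp add: \<beta>_def L2_norm_scaleR)
  have \<Phi>: "\<Phi> \<le> C * N * t" using disp(1) by (simp add: \<Phi>_def N_def algebra_simps)
  have nN: "n\<^sub>1\<^sup>2 + n\<^sub>2\<^sup>2 \<le> N\<^sup>2" "N * n\<^sub>1 \<le> N\<^sup>2" "0 \<le> N"
    using pos by (auto simp: N_def power2_eq_square algebra_simps)
  have "C * t\<^sup>2 * (n\<^sub>1\<^sup>2 + n\<^sub>2\<^sup>2) \<le> C * t\<^sup>2 * N\<^sup>2" using pos nN(1) by (intro mult_left_mono) auto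
  then have e12: "C * n\<^sub>1\<^sup>2 * t\<^sup>2 + C * n\<^sub>2\<^sup>2 * t\<^sup>2 \<le> C * N\<^sup>2 * t\<^sup>2" by (simp add: algebra_simps)
  have \<Phi>\<beta>: "\<bar>\<Phi> - t * \<beta>\<bar> \<le> C * N\<^sup>2 * t\<^sup>2" using disp(2) e12 unfolding \<beta> \<Phi>_def by simp
  have W\<Phi>: "W \<le> \<Phi>"
    unfolding W_def \<Phi>_def by (rule wasserstein_le_L2_norm[OF l(2) p \<mu> \<Omega>])
  have "\<Phi> \<le> W + (C * N\<^sup>2 * t\<^sup>2 + C\<^sup>2 * N\<^sup>2 * t\<^sup>2) + 4 * (C * N * t) * \<Phi>"
    unfolding W_def \<Phi>_def
  proof (rule L2_norm_le_wasserstein[OF l(1,2) p \<mu> \<Omega> GDERIV_diff[OF G(2) G(1)]])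
    have lipG: "norm ((G\<^sub>2 x - G\<^sub>1 x) - (G\<^sub>2 y - G\<^sub>1 y)) \<le> C * N * t * norm (x - y)" for x y
    proof -
      have "norm ((G\<^sub>2 x - G\<^sub>1 x) - (G\<^sub>2 y - G\<^sub>1 y)) \<le> norm (G\<^sub>2 x - G\<^sub>2 y) + norm (G\<^sub>1 x - G\<^sub>1 y)"
        using norm_triangle_ineq4[of "G\<^sub>2 x - G\<^sub>2 y" "G\<^sub>1 x - G\<^sub>1 y"] by (simp add: algebra_simps)
      also have "\<dots> \<le> (C * n\<^sub>2 * t) * norm (x - y) + (C * n\<^sub>1 * t) * norm (x - y)"
        by (intro add_mono Glip)
      finally show ?thesis by (simp add: N_def algebra_simps)
    qed
    then show "norm ((G\<^sub>2 x - G\<^sub>1 x) - (G\<^sub>2 y - G\<^sub>1 y)) \<le> C * N * t * norm (x - y)" for x y .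
    show N0: "0 \<le> C * N * t" using pos nN(3) by simp
    show "norm (p\<^sub>2 x - p\<^sub>1 x - (G\<^sub>2 (p\<^sub>1 x) - G\<^sub>1 (p\<^sub>1 x))) \<le> C * N\<^sup>2 * t\<^sup>2 + C\<^sup>2 * N\<^sup>2 * t\<^sup>2" for x
    proof -
      \<comment> \<open>The gradient is needed at the starting point \<open>p\<^sub>1 x\<close> of
        the coupling, whereas the expansions are centred at \<open>x\<close>. Moving the base point
        costs its Lipschitz constant times \<open>norm (p\<^sub>1 x - x)\<close>.\<close>
      have "p\<^sub>2 x - p\<^sub>1 x - (G\<^sub>2 (p\<^sub>1 x) - G\<^sub>1 (p\<^sub>1 x)) = ((p\<^sub>2 x - x - G\<^sub>2 x) - (p\<^sub>1 x - x - G\<^sub>1 x))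
          - ((G\<^sub>2 (p\<^sub>1 x) - G\<^sub>1 (p\<^sub>1 x)) - (G\<^sub>2 x - G\<^sub>1 x))" by simp
      also have "norm \<dots> \<le> (norm (p\<^sub>2 x - x - G\<^sub>2 x) + norm (p\<^sub>1 x - x - G\<^sub>1 x))
          + norm ((G\<^sub>2 (p\<^sub>1 x) - G\<^sub>1 (p\<^sub>1 x)) - (G\<^sub>2 x - G\<^sub>1 x))"
        by (rule order_trans[OF norm_triangle_ineq4 add_right_mono[OF norm_triangle_ineq4]])
      also have "\<dots> \<le> (C * n\<^sub>2\<^sup>2 * t\<^sup>2 + C * n\<^sub>1\<^sup>2 * t\<^sup>2) + C * N * t * norm (p\<^sub>1 x - x)"
        using e[folded G\<^sub>1_def G\<^sub>2_def] by (intro add_mono lipG)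
      also have "\<dots> \<le> C * N\<^sup>2 * t\<^sup>2 + C * N * t * (C * n\<^sub>1 * t)"
        using e12 mult_left_mono[OF m(1)[of x] N0] by simp
      also have "C * N * t * (C * n\<^sub>1 * t) = C\<^sup>2 * t\<^sup>2 * (N * n\<^sub>1)" by (simp add: power2_eq_square)
      also have "\<dots> \<le> C\<^sup>2 * t\<^sup>2 * N\<^sup>2" using nN(2) by (intro mult_left_mono) auto
      finally show ?thesis by (simp add: mult_ac)
    qed
  qed
  moreover have "(C * N * t) * \<Phi> \<le> C\<^sup>2 * N\<^sup>2 * t\<^sup>2"
    using mult_left_mono[OF \<Phi>, of "C * N * t"] pos nN(3) by (simp add: power2_eq_square mult_ac)
  ultimately have "\<bar>W - \<Phi>\<bar> \<le> C * N\<^sup>2 * t\<^sup>2 + 5 * (C\<^sup>2 * N\<^sup>2 * t\<^sup>2)" using W\<Phi> by simp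
  with \<Phi>\<beta> have "\<bar>W - t * \<beta>\<bar> \<le> 2 * (C * N\<^sup>2 * t\<^sup>2) + 5 * (C\<^sup>2 * N\<^sup>2 * t\<^sup>2)" by linarith
  then show "\<bar>W - t * \<beta>\<bar> \<le> (2 * C + 5 * C\<^sup>2) * (n\<^sub>1 + n\<^sub>2)\<^sup>2 * t\<^sup>2"
    by (simp add: N_def algebra_simps)
  \<comment> \<open>The deviation of an optimal map grows like \<open>n\<close> to the power 3/2;
    bounding one factor \<open>sqrt n\<close> by \<open>sqrt R\<close> leaves linear dependence on
    \<open>n\<close>.\<close>
  have rate: "2 * sqrt (C * n * t) * (C * n * t) \<le> 2 * C * sqrt (C * R) * n * t powr (3 / 2)"
    if "0 \<le> n" "n \<le> R" for n R
  proof -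
    have t32: "sqrt t * t = t powr (3 / 2)"
    proof (cases "t = 0")
      case False
      then show ?thesis using pos(4) powr_add[of t "1 / 2" 1] by (simp add: powr_half_sqrt)
    qed simp
    have "2 * sqrt (C * n * t) * (C * n * t) = 2 * C * sqrt (C * n) * n * (sqrt t * t)"
      by (simp add: real_sqrt_mult)
    also have "\<dots> \<le> 2 * C * sqrt (C * R) * n * (sqrt t * t)"
      using that pos by (intro mult_right_mono mult_left_mono real_sqrt_le_mono) auto
    finally show ?thesis by (simp add: t32)
  qed
  show "\<bar>L2_norm \<rho> (\<lambda>x. T\<^sub>1 x - T\<^sub>2 x) - t * \<beta>\<bar>
      \<le> C * (n\<^sub>1 + n\<^sub>2)\<^sup>2 * t\<^sup>2 + 2 * C * sqrt (C * R) * (n\<^sub>1 + n\<^sub>2) * t powr (3 / 2)"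
    if T: "optimal_map \<rho> (distr \<rho> borel p\<^sub>1) T\<^sub>1" "optimal_map \<rho> (distr \<rho> borel p\<^sub>2) T\<^sub>2"
      and R: "n\<^sub>1 \<le> R" "n\<^sub>2 \<le> R" for T\<^sub>1 T\<^sub>2 R
  proof -
    note e' = e[folded G\<^sub>1_def G\<^sub>2_def]
    have "\<bar>L2_norm \<rho> (\<lambda>x. T\<^sub>1 x - T\<^sub>2 x) - t * \<beta>\<bar>
      \<le> (C * n\<^sub>1\<^sup>2 * t\<^sup>2 + 2 * sqrt (C * n\<^sub>1 * t) * (C * n\<^sub>1 * t))
        + (C * n\<^sub>2\<^sup>2 * t\<^sup>2 + 2 * sqrt (C * n\<^sub>2 * t) * (C * n\<^sub>2 * t))"
      using disp(3)[OF T optimal_map_deviation[OF \<rho> \<mu>(1) \<Omega> p(1) T(1) G(1) Glip(1) K0(1) m(1) e'(1)]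
          optimal_map_deviation[OF \<rho> \<mu>(2) \<Omega> p(2) T(2) G(2) Glip(2) K0(2) m(2) e'(2)]]
      unfolding \<beta> .
    also have "\<dots> \<le> C * N\<^sup>2 * t\<^sup>2 + (2 * C * sqrt (C * R) * n\<^sub>1 * t powr (3 / 2)
        + 2 * C * sqrt (C * R) * n\<^sub>2 * t powr (3 / 2))"
      using e12 rate[OF pos(2) R(1)] rate[OF pos(3) R(2)] by linarith
    finally show ?thesis by (simp add: N_def algebra_simps)
  qed
qed

lemma has_real_derivative_at_right_0:
  fixes f :: "real \<Rightarrow> real"
  assumes "\<And>t. 0 \<le> t \<Longrightarrow> t \<le> 1 \<Longrightarrow> \<bar>f t - t * b\<bar> \<le> K * t\<^sup>2"
  shows "(f has_real_derivative b) (at_right 0)"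
  unfolding has_field_derivative_iff
proof (rule LIM_zero_cancel, rule Lim_null_comparison)
  \<comment> \<open>The estimate at \<open>t = 0\<close> itself forces this value.\<close>
  have f0: "f 0 = 0" using assms[of 0] by simp
  have "\<forall>\<^sub>F t in at_right 0. t \<in> {0<..<1::real}" by (rule eventually_at_right_real) simp
  then show "\<forall>\<^sub>F t in at_right 0. norm ((f t - f 0) / (t - 0) - b) \<le> K * t"
  proof eventually_elim
    case (elim t)
    have "(f t - f 0) / (t - 0) - b = (f t - t * b) / t" using elim by (simp add: f0 field_simps)
    then have "norm ((f t - f 0) / (t - 0) - b) = \<bar>f t - t * b\<bar> / t" using elim by (simp add: abs_divide)
    also have "\<dots> \<le> K * t\<^sup>2 / t" using assms[of t] elim by (intro divide_right_mono) auto
    also have "\<dots> = K * t" using elim by (simp add: power2_eq_square)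
    finally show ?case .
  qed
  have "((\<lambda>t. K * t) \<longlongrightarrow> K * 0) (at_right 0)" by (intro tendsto_intros)
  then show "((\<lambda>t. K * t) \<longlongrightarrow> 0) (at_right 0)" by simp
qed

theorem corollary2p17:
  fixes A :: "('p::{t2_space, second_countable_topology}, 'e::euclidean_space) chart set"
    and g :: "('p, 'e) metric_tensor"
    and S :: "'p set"
    and D :: "('p \<times> ('p, 'e) tvec) set"
    and \<Omega> :: "'a::euclidean_space set"
    and E :: "'p \<Rightarrow> 'a measure"
    and B :: "'p \<Rightarrow> ('p, 'e) tvec \<Rightarrow> 'a \<Rightarrow> 'a"
  assumes "compact \<Omega>" and "convex \<Omega>"
    and "parameter_manifold A g S" and "exp_domain A g S D"
    and "measure_embedding A g S \<Omega> E"
    and "velocity_fields A g S D E B"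
    and "transported_by_flow A g S \<Omega> E B"
  shows "\<exists>C::real>0. \<forall>\<theta> \<eta>\<^sub>1 \<eta>\<^sub>2. (\<theta>, \<eta>\<^sub>1) \<in> D \<and> (\<theta>, \<eta>\<^sub>2) \<in> D \<longrightarrow>
    (\<forall>t T\<^sub>1 T\<^sub>2. 0 \<le> t \<and>
        ereal t < min 1 (min (1 / ereal (C * tnorm g \<theta> \<eta>\<^sub>1)) (1 / ereal (C * tnorm g \<theta> \<eta>\<^sub>2))) \<and>
        optimal_map (E \<theta>) (E (exp_map A g \<theta> (tv_scale t \<eta>\<^sub>1))) T\<^sub>1 \<and>
        optimal_map (E \<theta>) (E (exp_map A g \<theta> (tv_scale t \<eta>\<^sub>2))) T\<^sub>2 \<longrightarrow>
      \<bar>wasserstein (E (exp_curve A g \<theta> \<eta>\<^sub>1 t)) (E (exp_curve A g \<theta> \<eta>\<^sub>2 t))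
          - L2_norm (E \<theta>) (\<lambda>x. T\<^sub>1 x - T\<^sub>2 x)\<bar>
        \<le> t\<^sup>2 * C * (tnorm g \<theta> \<eta>\<^sub>1 + tnorm g \<theta> \<eta>\<^sub>2)\<^sup>2
          + t powr (3 / 2) * C * (tnorm g \<theta> \<eta>\<^sub>1 + tnorm g \<theta> \<eta>\<^sub>2)) \<and>
    ((\<lambda>t. wasserstein (E (exp_curve A g \<theta> \<eta>\<^sub>1 t)) (E (exp_curve A g \<theta> \<eta>\<^sub>2 t)))
      has_real_derivative L2_norm (E \<theta>) (B \<theta> (tv_diff \<eta>\<^sub>1 \<eta>\<^sub>2))) (at_right 0)"
proof -
  note \<Omega> = assms(1) and D = assms(4) and E = assms(5) and B = assms(6)
  have g: "riemannian_metric A g"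
    using assms(3) by (simp add: parameter_manifold_def riemannian_manifold_def)
  obtain R' where R': "\<And>\<theta> \<eta>. (\<theta>, \<eta>) \<in> D \<Longrightarrow> tnorm g \<theta> \<eta> \<le> R'"
    using tnorm_exp_domain_bounded[OF D E \<Omega>] by blast
  define R where "R = max R' 0"
  have R: "0 \<le> R" "\<And>\<theta> \<eta>. (\<theta>, \<eta>) \<in> D \<Longrightarrow> tnorm g \<theta> \<eta> \<le> R"
    using R' by (auto simp: R_def intro: max.coboundedI1)
  obtain C where C: "C > 0"
    "\<And>\<theta> \<eta> x y. (\<theta>, \<eta>) \<in> D \<Longrightarrow> norm (B \<theta> \<eta> x - B \<theta> \<eta> y) \<le> C * tnorm g \<theta> \<eta> * norm (x - y)"
    "\<And>\<theta> \<eta> t. (\<theta>, \<eta>) \<in> D \<Longrightarrow> t \<in> {0..1} \<Longrightarrow> \<exists>p. p \<in> borel_measurable borel \<and>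
       distr (E \<theta>) borel p = E (exp_curve A g \<theta> \<eta> t) \<and>
       (\<forall>x. norm (p x - x) \<le> C * tnorm g \<theta> \<eta> * t) \<and>
       (\<forall>x. norm (p x - x - t *\<^sub>R B \<theta> \<eta> x) \<le> C * (tnorm g \<theta> \<eta>)\<^sup>2 * t\<^sup>2)"
    by (rule exp_curve_transport_map[OF \<Omega> g D E B assms(7)]) (rule that, assumption+)
  \<comment> \<open>Of \<open>3 * C\<close>, two come from the estimate of the distance and one from
    the optimal maps. The term \<open>5 * C\<^sup>2\<close> belongs to the distance, the last one to
    the power 3/2.\<close>
  define C' where "C' = 3 * C + 5 * C\<^sup>2 + 2 * C * sqrt (C * R)"
  have C': "0 < C'" "3 * C + 5 * C\<^sup>2 \<le> C'" "2 * C * sqrt (C * R) \<le> C'"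
    using C(1) R(1) by (auto simp: C'_def intro!: add_pos_nonneg)
  have P: "E \<theta> \<in> prob_measures_on \<Omega>" if "\<theta> \<in> S" for \<theta>
    using E that unfolding measure_embedding_def by blast
  show ?thesis
  proof (intro exI[of _ C'] conjI allI impI C'(1))
    fix \<theta> \<eta>\<^sub>1 \<eta>\<^sub>2 assume "(\<theta>, \<eta>\<^sub>1) \<in> D \<and> (\<theta>, \<eta>\<^sub>2) \<in> D"
    then have \<eta>: "(\<theta>, \<eta>\<^sub>1) \<in> D" "(\<theta>, \<eta>\<^sub>2) \<in> D" by auto
    note d\<^sub>1 = exp_domainD[OF D \<eta>(1)] and d\<^sub>2 = exp_domainD[OF D \<eta>(2)]
    define n\<^sub>1 n\<^sub>2 where "n\<^sub>1 = tnorm g \<theta> \<eta>\<^sub>1" and "n\<^sub>2 = tnorm g \<theta> \<eta>\<^sub>2"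
    define W where "W t = wasserstein (E (exp_curve A g \<theta> \<eta>\<^sub>1 t)) (E (exp_curve A g \<theta> \<eta>\<^sub>2 t))" for t
    define \<beta> where "\<beta> = L2_norm (E \<theta>) (\<lambda>x. B \<theta> \<eta>\<^sub>1 x - B \<theta> \<eta>\<^sub>2 x)"
    have n: "0 \<le> n\<^sub>1" "0 \<le> n\<^sub>2" "n\<^sub>1 \<le> R" "n\<^sub>2 \<le> R"
      using tnorm_nonneg[OF g d\<^sub>1(2)] tnorm_nonneg[OF g d\<^sub>2(2)] R(2)[OF \<eta>(1)] R(2)[OF \<eta>(2)]
      by (auto simp: n\<^sub>1_def n\<^sub>2_def)
    \<comment> \<open>Distance and optimal maps are both compared with \<open>t * \<beta>\<close>;
      adding the bounds gives the inequality, and the first alone gives the derivative.\<close>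
    have est: "\<bar>W t - t * \<beta>\<bar> \<le> (2 * C + 5 * C\<^sup>2) * (n\<^sub>1 + n\<^sub>2)\<^sup>2 * t\<^sup>2"
      "\<And>T\<^sub>1 T\<^sub>2. \<lbrakk>optimal_map (E \<theta>) (E (exp_curve A g \<theta> \<eta>\<^sub>1 t)) T\<^sub>1;
         optimal_map (E \<theta>) (E (exp_curve A g \<theta> \<eta>\<^sub>2 t)) T\<^sub>2\<rbrakk> \<Longrightarrow>
         \<bar>L2_norm (E \<theta>) (\<lambda>x. T\<^sub>1 x - T\<^sub>2 x) - t * \<beta>\<bar>
         \<le> C * (n\<^sub>1 + n\<^sub>2)\<^sup>2 * t\<^sup>2 + 2 * C * sqrt (C * R) * (n\<^sub>1 + n\<^sub>2) * t powr (3 / 2)"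
      if t: "0 \<le> t" "t \<le> 1" for t
    proof -
      have t': "t \<in> {0..1}" using t by simp
      obtain p\<^sub>1 where p\<^sub>1: "p\<^sub>1 \<in> borel_measurable borel" "distr (E \<theta>) borel p\<^sub>1 = E (exp_curve A g \<theta> \<eta>\<^sub>1 t)"
        "\<And>x. norm (p\<^sub>1 x - x) \<le> C * n\<^sub>1 * t" "\<And>x. norm (p\<^sub>1 x - x - t *\<^sub>R B \<theta> \<eta>\<^sub>1 x) \<le> C * n\<^sub>1\<^sup>2 * t\<^sup>2"
        using C(3)[OF \<eta>(1) t'] unfolding n\<^sub>1_def by blast
      obtain p\<^sub>2 where p\<^sub>2: "p\<^sub>2 \<in> borel_measurable borel" "distr (E \<theta>) borel p\<^sub>2 = E (exp_curve A g \<theta> \<eta>\<^sub>2 t)"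
        "\<And>x. norm (p\<^sub>2 x - x) \<le> C * n\<^sub>2 * t" "\<And>x. norm (p\<^sub>2 x - x - t *\<^sub>R B \<theta> \<eta>\<^sub>2 x) \<le> C * n\<^sub>2\<^sup>2 * t\<^sup>2"
        using C(3)[OF \<eta>(2) t'] unfolding n\<^sub>2_def by blast
      have \<mu>: "distr (E \<theta>) borel p\<^sub>1 \<in> prob_measures_on \<Omega>" "distr (E \<theta>) borel p\<^sub>2 \<in> prob_measures_on \<Omega>"
        using P d\<^sub>1(6)[OF t'] d\<^sub>2(6)[OF t'] by (simp_all add: p\<^sub>1(2) p\<^sub>2(2))
      note w = wasserstein_displacements[OF P[OF d\<^sub>1(1)] \<mu> \<Omega> p\<^sub>1(1) p\<^sub>2(1)
          velocity_fieldsD(3)[OF B d\<^sub>1(1,2)] velocity_fieldsD(3)[OF B d\<^sub>2(1,2)]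
          C(2)[OF \<eta>(1), folded n\<^sub>1_def] C(2)[OF \<eta>(2), folded n\<^sub>2_def]
          p\<^sub>1(3) p\<^sub>2(3) p\<^sub>1(4) p\<^sub>2(4) C(1) n(1,2) t(1), unfolded p\<^sub>1(2) p\<^sub>2(2), folded \<beta>_def]
      show "\<bar>W t - t * \<beta>\<bar> \<le> (2 * C + 5 * C\<^sup>2) * (n\<^sub>1 + n\<^sub>2)\<^sup>2 * t\<^sup>2"
        unfolding W_def by (rule w(1))
      show "\<bar>L2_norm (E \<theta>) (\<lambda>x. T\<^sub>1 x - T\<^sub>2 x) - t * \<beta>\<bar>
         \<le> C * (n\<^sub>1 + n\<^sub>2)\<^sup>2 * t\<^sup>2 + 2 * C * sqrt (C * R) * (n\<^sub>1 + n\<^sub>2) * t powr (3 / 2)"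
        if "optimal_map (E \<theta>) (E (exp_curve A g \<theta> \<eta>\<^sub>1 t)) T\<^sub>1"
          "optimal_map (E \<theta>) (E (exp_curve A g \<theta> \<eta>\<^sub>2 t)) T\<^sub>2" for T\<^sub>1 T\<^sub>2
        by (rule w(2)[OF that n(3,4)])
    qed
    \<comment> \<open>The difference of the two tangent vectors need not belong to \<open>D\<close>,
      so \<open>\<beta>\<close> was formed from the two fields separately; linearity of
      \<open>B\<close> now identifies it with the claimed derivative.\<close>
    have W_eq: "W = (\<lambda>t. wasserstein (E (exp_curve A g \<theta> \<eta>\<^sub>1 t)) (E (exp_curve A g \<theta> \<eta>\<^sub>2 t)))"
      by (simp add: W_def fun_eq_iff)
    have "B \<theta> (tv_diff \<eta>\<^sub>1 \<eta>\<^sub>2) = (\<lambda>x. B \<theta> \<eta>\<^sub>1 x - B \<theta> \<eta>\<^sub>2 x)"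
      using velocity_fieldsD(4)[OF B d\<^sub>1(1,2) d\<^sub>2(2)] by blast
    then show "((\<lambda>t. wasserstein (E (exp_curve A g \<theta> \<eta>\<^sub>1 t)) (E (exp_curve A g \<theta> \<eta>\<^sub>2 t)))
      has_real_derivative L2_norm (E \<theta>) (B \<theta> (tv_diff \<eta>\<^sub>1 \<eta>\<^sub>2))) (at_right 0)"
      using has_real_derivative_at_right_0[of W \<beta>, OF est(1)] by (simp add: W_eq \<beta>_def)
    fix t T\<^sub>1 T\<^sub>2
    assume a: "0 \<le> t \<and>
        ereal t < min 1 (min (1 / ereal (C' * tnorm g \<theta> \<eta>\<^sub>1)) (1 / ereal (C' * tnorm g \<theta> \<eta>\<^sub>2))) \<and>
        optimal_map (E \<theta>) (E (exp_map A g \<theta> (tv_scale t \<eta>\<^sub>1))) T\<^sub>1 \<and>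
        optimal_map (E \<theta>) (E (exp_map A g \<theta> (tv_scale t \<eta>\<^sub>2))) T\<^sub>2"
    have "ereal t < 1" using a by (simp only: min_less_iff_conj)
    then have t: "0 \<le> t" "t \<le> 1" using a by auto
    have T: "optimal_map (E \<theta>) (E (exp_curve A g \<theta> \<eta>\<^sub>1 t)) T\<^sub>1"
      "optimal_map (E \<theta>) (E (exp_curve A g \<theta> \<eta>\<^sub>2 t)) T\<^sub>2"
      using a by (simp_all only: exp_curve_def)
    have "\<bar>W t - L2_norm (E \<theta>) (\<lambda>x. T\<^sub>1 x - T\<^sub>2 x)\<bar>
        \<le> (2 * C + 5 * C\<^sup>2) * (n\<^sub>1 + n\<^sub>2)\<^sup>2 * t\<^sup>2 + (C * (n\<^sub>1 + n\<^sub>2)\<^sup>2 * t\<^sup>2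
          + 2 * C * sqrt (C * R) * (n\<^sub>1 + n\<^sub>2) * t powr (3 / 2))"
      using est(1)[OF t] est(2)[OF t T] by linarith
    also have "\<dots> = (3 * C + 5 * C\<^sup>2) * ((n\<^sub>1 + n\<^sub>2)\<^sup>2 * t\<^sup>2)
        + (2 * C * sqrt (C * R)) * ((n\<^sub>1 + n\<^sub>2) * t powr (3 / 2))"
      by (simp add: algebra_simps)
    also have "\<dots> \<le> C' * ((n\<^sub>1 + n\<^sub>2)\<^sup>2 * t\<^sup>2) + C' * ((n\<^sub>1 + n\<^sub>2) * t powr (3 / 2))"
      using C'(2,3) n by (intro add_mono mult_right_mono) auto
    finally show "\<bar>wasserstein (E (exp_curve A g \<theta> \<eta>\<^sub>1 t)) (E (exp_curve A g \<theta> \<eta>\<^sub>2 t))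
          - L2_norm (E \<theta>) (\<lambda>x. T\<^sub>1 x - T\<^sub>2 x)\<bar>
        \<le> t\<^sup>2 * C' * (tnorm g \<theta> \<eta>\<^sub>1 + tnorm g \<theta> \<eta>\<^sub>2)\<^sup>2
          + t powr (3 / 2) * C' * (tnorm g \<theta> \<eta>\<^sub>1 + tnorm g \<theta> \<eta>\<^sub>2)"
      unfolding W_def n\<^sub>1_def n\<^sub>2_def by (simp add: mult_ac)
  qed
qed

end
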